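(* Let $n\ge 1$ and $0\le t\le\lfloor\frac{n-1}{2}\rfloor$. Then $$Kf(C_{n,t})=\begin{cases}\frac{1}{18}\left(3n^3-3n-12nt^2-6nt+8t^3+12t^2-2t\right), & \text{if } t \text{ is even},\\[4pt] \frac{1}{18}\left(3n^3-15n-12nt^2-6nt+8t^3+12t^2+22t+12\right), & \text{if } t\text{ is odd}.\end{cases}$$
   Context: All graphs are finite and simple. For a connected graph $G$, $R_G(a,b)$ denotes the resistance distance between vertices $a,b$, i.e. the effective resistance between $a$ and $b$ when every edge of $G$ is replaced by a unit resistor. The Kirchhoff index is $Kf(G)=\sum_{\{a,b\}\subseteq V(G)}R_G(a,b)$, the sum over unordered pairs of distinct vertices. A cactus is a connected graph each of whose blocks is either an edge or a cycle. A chain cactus is a cactus in which each block has at most two cut vertices and each cut vertex is shared by exactly two blocks. A chain cactus with at least two blocks has exactly two blocks containing only one cut vertex, called terminal blocks. For $j\ge 1$, $Q_j$ is the chain cactus whose blocks are exactly $j$ triangles (so $|V(Q_j)|=2j+1$, and $Q_1$ is a single triangle); $Q_0$ is a single vertex. $P_s=r_1r_2\cdots r_s$ is the path on $s\ge 1$ vertices (for $s=1$ a single vertex $r_1=r_s$). Definition of $C_{n,t}$: put $k=\lfloor t/2\rfloor$ and $s=n-2t\ge 1$. Let $u$ be a vertex of degree 2 in a terminal block of $Q_k$ and $v$ a vertex of degree 2 in a terminal block of $Q_{t-k}$ (any vertex, if the corresponding graph is a single triangle or a single vertex). $C_{n,t}$ is obtained from the disjoint union of $Q_k$, $P_s$,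 $Q_{t-k}$ by identifying $u$ with $r_1$ and $v$ with $r_s$. It has $n$ vertices and $t$ cycles, and is well defined up to isomorphism. *)

theory Defs
  imports Complex_Main "Graph_Theory.Graph_Theory"
begin

text \<open>
  A finite simple graph is a \<open>pair_graph\<close> (finite, loop-free, symmetric, no parallel arcs):
  each edge \<open>{x, y}\<close> is represented by the two arcs \<open>(x, y)\<close> and \<open>(y, x)\<close>. For such a graph
  the degree of a vertex is its \<open>out_degree\<close>, and \<open>reachable\<close> is the relation of being in the
  same component.
\<close>

subsection \<open>Blocks, cacti and chain cacti\<close>

definition cut_vertex :: "('a, 'b) pre_digraph \<Rightarrow> 'a \<Rightarrow> bool" where
  "cut_vertex G x \<longleftrightarrow> x \<in> verts G \<and>
     (\<exists>y z. y \<noteq> x \<and> z \<noteq> x \<and> y \<rightarrow>\<^sup>*\<^bsub>G\<^esub> z \<and> \<not> y \<rightarrow>\<^sup>*\<^bsub>pre_digraph.del_vert G x\<^esub> z)"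

definition nonseparable :: "('a, 'b) pre_digraph \<Rightarrow> bool" where
  "nonseparable G \<longleftrightarrow> graph G \<and> connected G \<and> (\<forall>x. \<not> cut_vertex G x)"

definition blocks :: "('a, 'b) pre_digraph \<Rightarrow> ('a, 'b) pre_digraph set" where
  "blocks G = {B. pre_digraph.max_subgraph G nonseparable B}"

definition is_edge_graph :: "('a, 'b) pre_digraph \<Rightarrow> bool" where
  "is_edge_graph G \<longleftrightarrow> graph G \<and> connected G \<and> card (verts G) = 2"

definition is_cycle_graph :: "('a, 'b) pre_digraph \<Rightarrow> bool" where
  "is_cycle_graph G \<longleftrightarrow> graph G \<and> connected G \<and> (\<forall>x\<in>verts G. out_degree G x = 2)"

definition is_triangle :: "('a, 'b) pre_digraph \<Rightarrow> bool" where
  "is_triangle G \<longleftrightarrow> is_cycle_graph G \<and> card (verts G) = 3"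

definition cactus :: "('a, 'b) pre_digraph \<Rightarrow> bool" where
  "cactus G \<longleftrightarrow> graph G \<and> connected G \<and> (\<forall>B\<in>blocks G. is_edge_graph B \<or> is_cycle_graph B)"

text \<open>Cut vertices of a block are always meant as cut vertices of the ambient graph.\<close>

definition block_cut_vertices :: "('a, 'b) pre_digraph \<Rightarrow> ('a, 'b) pre_digraph \<Rightarrow> 'a set" where
  "block_cut_vertices G B = {x \<in> verts B. cut_vertex G x}"

definition chain_cactus :: "('a, 'b) pre_digraph \<Rightarrow> bool" where
  "chain_cactus G \<longleftrightarrow> cactus G
     \<and> (\<forall>B\<in>blocks G. card (block_cut_vertices G B) \<le> 2)
     \<and> (\<forall>x. cut_vertex G x \<longrightarrow> card {B \<in> blocks G. x \<in> verts B} = 2)"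

definition terminal_block :: "('a, 'b) pre_digraph \<Rightarrow> ('a, 'b) pre_digraph \<Rightarrow> bool" where
  "terminal_block G B \<longleftrightarrow> B \<in> blocks G \<and> card (block_cut_vertices G B) = 1"

subsection \<open>The graphs $Q_j$, $P_s$ and $C_{n,t}$\<close>

text \<open>\<open>is_Q j G\<close> says that \<open>G\<close> is a copy of $Q_j$.\<close>

definition is_Q :: "nat \<Rightarrow> 'a pair_pre_digraph \<Rightarrow> bool" where
  "is_Q j G \<longleftrightarrow> pair_graph G \<and>
     (if j = 0 then card (pverts G) = 1
      else chain_cactus (with_proj G) \<and> (\<forall>B\<in>blocks (with_proj G). is_triangle B)
           \<and> card (blocks (with_proj G)) = j)"

text \<open>
  Vertices of $Q_j$ that may be identified with an end of the path. The graphs with fewer than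
  two blocks are the single vertex and the single triangle, where any vertex is allowed.
\<close>

definition attachment_vertex :: "'a pair_pre_digraph \<Rightarrow> 'a \<Rightarrow> bool" where
  "attachment_vertex G u \<longleftrightarrow> u \<in> pverts G \<and>
     (card (blocks (with_proj G)) \<ge> 2 \<longrightarrow>
        out_degree (with_proj G) u = 2 \<and> (\<exists>B. terminal_block (with_proj G) B \<and> u \<in> verts B))"

definition path_graph :: "nat \<Rightarrow> nat pair_pre_digraph" where
  "path_graph s = \<lparr> pverts = {1..s},
     parcs = {(i, j). i \<in> {1..s} \<and> j \<in> {1..s} \<and> (j = Suc i \<or> i = Suc j)} \<rparr>"

definition disjoint_union ::
  "'a pair_pre_digraph \<Rightarrow> 'b pair_pre_digraph \<Rightarrow> ('a + 'b) pair_pre_digraph" where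
  "disjoint_union G H = \<lparr> pverts = pverts G <+> pverts H,
     parcs = map_prod Inl Inl ` parcs G \<union> map_prod Inr Inr ` parcs H \<rparr>"

text \<open>
  Quotient of \<open>G\<close> by the equivalence relation generated by \<open>r\<close>; the new vertices are the
  equivalence classes of the old ones.
\<close>

definition identify :: "'a rel \<Rightarrow> 'a pair_pre_digraph \<Rightarrow> 'a set pair_pre_digraph" where
  "identify r G = (let cls = (\<lambda>x. (r \<union> r\<inverse>)\<^sup>* `` {x}) in
     \<lparr> pverts = cls ` pverts G, parcs = map_prod cls cls ` parcs G \<rparr>)"

text \<open>
  $C_{n,t}$ built from a copy \<open>A\<close> of $Q_{\lfloor t/2\rfloor}$ with attachment vertex \<open>u\<close> and a copy
  \<open>B\<close> of $Q_{t-\lfloor t/2\rfloor}$ with attachment vertex \<open>v\<close>.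
\<close>

definition C_graph ::
  "nat \<Rightarrow> nat \<Rightarrow> 'a pair_pre_digraph \<Rightarrow> 'a \<Rightarrow> 'b pair_pre_digraph \<Rightarrow> 'b
     \<Rightarrow> ('a + nat + 'b) set pair_pre_digraph" where
  "C_graph n t A u B v = (let s = n - 2 * t in
     identify {(Inl u, Inr (Inl 1)), (Inr (Inr v), Inr (Inl s))}
       (disjoint_union A (disjoint_union (path_graph s) B)))"

subsection \<open>Resistance distance and Kirchhoff index\<close>

text \<open>
  \<open>\<phi>\<close> is a vertex potential for a unit current entering at \<open>a\<close> and leaving at \<open>b\<close>: by Ohm's law
  with unit resistors, \<open>\<phi> x - \<phi> y\<close> is the current along the edge from \<open>x\<close> to \<open>y\<close>, and the
  equation is Kirchhoff's current law at \<open>x\<close>.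
\<close>

definition unit_current_potential ::
  "'a pair_pre_digraph \<Rightarrow> 'a \<Rightarrow> 'a \<Rightarrow> ('a \<Rightarrow> real) \<Rightarrow> bool" where
  "unit_current_potential G a b \<phi> \<longleftrightarrow>
     (\<forall>x\<in>pverts G. (\<Sum>y | (x, y) \<in> parcs G. \<phi> x - \<phi> y) = of_bool (x = a) - of_bool (x = b))"

definition resistance_distance :: "'a pair_pre_digraph \<Rightarrow> 'a \<Rightarrow> 'a \<Rightarrow> real" where
  "resistance_distance G a b =
     (THE r. \<exists>\<phi>. unit_current_potential G a b \<phi> \<and> r = \<phi> a - \<phi> b)"

text \<open>The sum ranges over unordered pairs; the resistance distance is symmetric.\<close>

definition kirchhoff_index :: "'a pair_pre_digraph \<Rightarrow> real" where
  "kirchhoff_index G = (\<Sum>p | p \<subseteq> pverts G \<and> card p = 2.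
     (THE r. \<exists>a b. p = {a, b} \<and> r = resistance_distance G a b))"

end

theory Submission
  imports Defs
begin

text \<open>
  The Laplacian is self-adjoint, so any two potentials for the same unit current have the same
  potential difference; hence it suffices to exhibit one potential for each pair of vertices. If two
  networks share exactly one vertex, potentials of the parts combine to potentials of the union. So
  resistances add along series compositions, and the order, the terminal resistance, the resistance
  sums of the terminals and the Kirchhoff index of a composite are polynomials in those of its parts.

  It remains to recognise $Q_j$ as a series composition of triangles. A vertex shared by two blocks is
  a cut vertex, for otherwise a path avoiding it would merge the two blocks into a larger nonseparable
  subgraph. So every vertex lies in at most two triangles, and the chain can be grown triangle by
  triangle from the one containing the attachment vertex.
\<close>

section \<open>Electrical networks\<close>

text \<open>Resistance is given by a definite description, so each value needs existence as well as
  uniqueness of a potential. Existence is built into the notion \<open>network\<close> and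
  inherited: the only potentials computed from scratch are those of cliques, and every graph in
  question is glued from cliques on one, two or three vertices. The vertices of C_{n,t} are
  equivalence classes, which is why invariance under relabelling enters. The copies of Q_j are known
  only through their blocks. The obstacle there is to show that a new triangle meets the grown chain
  in exactly one vertex, and this comes from counting: a triangle has at most two shared vertices,
  and in each triangle after the start one of them is spent on its entry, so a single vertex remains
  where the chain can continue. The degree condition on the attachment vertex makes it unshared and
  so provides the start.\<close>

definition laplacian :: "'a pair_pre_digraph \<Rightarrow> ('a \<Rightarrow> real) \<Rightarrow> 'a \<Rightarrow> real" where
  "laplacian G \<phi> x = (\<Sum>y | (x, y) \<in> parcs G. \<phi> x - \<phi> y)"

lemma unit_current_potential_laplacian:
  "unit_current_potential G a b \<phi> \<longleftrightarrow>
     (\<forall>x\<in>pverts G. laplacian G \<phi> x = of_bool (x = a) - of_bool (x = b))"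
  by (simp add: unit_current_potential_def laplacian_def)

text \<open>Solvability for every pair of vertices plays the part of connectedness: it is what
  \<open>resistance_distance\<close> requires, and gluing preserves it by an explicit
  construction.\<close>

definition network :: "'a pair_pre_digraph \<Rightarrow> bool" where
  "network G \<longleftrightarrow> finite (pverts G) \<and> parcs G \<subseteq> pverts G \<times> pverts G \<and> sym (parcs G) \<and>
     (\<forall>a\<in>pverts G. \<forall>b\<in>pverts G. \<exists>\<phi>. unit_current_potential G a b \<phi>)"

lemma networkD:
  assumes "network G"
  shows "finite (pverts G)" "parcs G \<subseteq> pverts G \<times> pverts G" "sym (parcs G)"
    "\<And>a b. a \<in> pverts G \<Longrightarrow> b \<in> pverts G \<Longrightarrow> \<exists>\<phi>. unit_current_potential G a b \<phi>"
  using assms by (auto simp: network_def)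

text \<open>Expanding gives a diagonal term symmetric in \<open>\<phi>\<close> and
  \<open>\<psi>\<close>, and a mixed term that is symmetric after interchanging the summations,
  because adjacency is symmetric.\<close>

lemma laplacian_self_adjoint:
  assumes "finite (pverts G)" "parcs G \<subseteq> pverts G \<times> pverts G" "sym (parcs G)"
  shows "(\<Sum>x\<in>pverts G. \<psi> x * laplacian G \<phi> x) = (\<Sum>x\<in>pverts G. \<phi> x * laplacian G \<psi> x)"
proof -
  let ?V = "pverts G" and ?e = "\<lambda>x y. of_bool ((x, y) \<in> parcs G) :: real"
  \<comment> \<open>An indicator lets the inner sum range over all vertices, so that the two
    summations can be interchanged.\<close>
  have lap: "laplacian G f x = (\<Sum>y\<in>?V. ?e x y * (f x - f y))" for f x
  proof -
    have "(\<Sum>y\<in>?V. ?e x y * (f x - f y)) = (\<Sum>y\<in>?V. if (x, y) \<in> parcs G then f x - f y else 0)"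
      by (intro sum.cong) auto
    also have "\<dots> = (\<Sum>y | y \<in> ?V \<and> (x, y) \<in> parcs G. f x - f y)"
      using assms(1) by (simp add: sum.inter_filter)
    also have "{y. y \<in> ?V \<and> (x, y) \<in> parcs G} = {y. (x, y) \<in> parcs G}"
      using assms(2) by auto
    finally show ?thesis by (simp add: laplacian_def)
  qed
  have e: "?e x y = ?e y x" for x y
    using symD[OF assms(3)] by (intro arg_cong[of _ _ of_bool]) blast
  have key: "(\<Sum>x\<in>?V. f x * laplacian G g x)
      = (\<Sum>x\<in>?V. \<Sum>y\<in>?V. ?e x y * f x * g x) - (\<Sum>x\<in>?V. \<Sum>y\<in>?V. ?e x y * f x * g y)" for f g
    unfolding lap sum_distrib_left sum_subtractf[symmetric]
    by (intro sum.cong refl) (simp add: algebra_simps)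
  have "(\<Sum>x\<in>?V. \<Sum>y\<in>?V. ?e x y * \<psi> x * \<phi> y) = (\<Sum>y\<in>?V. \<Sum>x\<in>?V. ?e x y * \<psi> x * \<phi> y)"
    by (rule sum.swap)
  also have "\<dots> = (\<Sum>x\<in>?V. \<Sum>y\<in>?V. ?e x y * \<phi> x * \<psi> y)"
  proof (intro sum.cong refl)
    fix x y show "?e y x * \<psi> y * \<phi> x = ?e x y * \<phi> x * \<psi> y" using e[of x y] by simp
  qed
  finally show ?thesis
    unfolding key by (simp add: mult_ac)
qed

text \<open>The Laplacian of \<open>\<phi>\<close> is the point mass at \<open>a\<close> minus that
  at \<open>b\<close>, also when \<open>a = b\<close>.\<close>

lemma sum_unit_current_potential:
  assumes "network G" "unit_current_potential G a b \<phi>" "a \<in> pverts G" "b \<in> pverts G"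
  shows "(\<Sum>x\<in>pverts G. \<psi> x * laplacian G \<phi> x) = \<psi> a - \<psi> b"
proof -
  have "(\<Sum>x\<in>pverts G. \<psi> x * laplacian G \<phi> x)
      = (\<Sum>x\<in>pverts G. (if x = a then \<psi> x else 0) - (if x = b then \<psi> x else 0))"
    using assms(2) by (intro sum.cong) (auto simp: unit_current_potential_laplacian)
  then show ?thesis
    using assms(3,4) networkD(1)[OF assms(1)] by (simp add: sum_subtractf)
qed

text \<open>Uniqueness of the potential difference needs no connectedness: pair one potential with the
  Laplacian of the other.\<close>

lemma resistance_distance_eqI:
  assumes "network G" "a \<in> pverts G" "b \<in> pverts G" "unit_current_potential G a b \<phi>"
  shows "resistance_distance G a b = \<phi> a - \<phi> b"
  unfolding resistance_distance_def
proof (rule the_equality)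
  fix r assume "\<exists>\<psi>. unit_current_potential G a b \<psi> \<and> r = \<psi> a - \<psi> b"
  then obtain \<psi> where \<psi>: "unit_current_potential G a b \<psi>" "r = \<psi> a - \<psi> b" by blast
  show "r = \<phi> a - \<phi> b"
    using laplacian_self_adjoint[of G \<phi> \<psi>] networkD(1-3)[OF assms(1)]
      sum_unit_current_potential[OF assms(1) \<psi>(1) assms(2,3), of \<phi>]
      sum_unit_current_potential[OF assms(1,4,2,3), of \<psi>] \<psi>(2) by simp
qed (use assms(4) in blast)

lemma resistance_distance_self:
  assumes "network G" "a \<in> pverts G"
  shows "resistance_distance G a a = 0"
  using resistance_distance_eqI[OF assms assms(2), of "\<lambda>_. 0"]
  by (simp add: unit_current_potential_def)

text \<open>Negating a potential reverses the current.\<close>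

lemma resistance_distance_commute:
  assumes "network G" "a \<in> pverts G" "b \<in> pverts G"
  shows "resistance_distance G a b = resistance_distance G b a"
proof -
  obtain \<phi> where \<phi>: "unit_current_potential G a b \<phi>"
    using networkD(4)[OF assms] by blast
  have "unit_current_potential G b a (\<lambda>x. - \<phi> x)"
    unfolding unit_current_potential_def
  proof
    fix x assume "x \<in> pverts G"
    have "(\<Sum>y | (x, y) \<in> parcs G. - \<phi> x - - \<phi> y) = - (\<Sum>y | (x, y) \<in> parcs G. \<phi> x - \<phi> y)"
      by (simp add: sum_negf[symmetric])
    then show "(\<Sum>y | (x, y) \<in> parcs G. - \<phi> x - - \<phi> y) = of_bool (x = b) - of_bool (x = a)"
      using \<phi> \<open>x \<in> pverts G\<close> by (simp add: unit_current_potential_def)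
  qed
  then show ?thesis
    using resistance_distance_eqI[OF assms \<phi>] resistance_distance_eqI[OF assms(1,3,2)] by simp
qed

definition resistance_sum :: "'a pair_pre_digraph \<Rightarrow> 'a \<Rightarrow> real" where
  "resistance_sum G a = (\<Sum>x\<in>pverts G. resistance_distance G a x)"

text \<open>Each unordered pair comes from two ordered ones and the diagonal contributes zero. Sums
  over vertices are easier to split and reindex than sums over two-element sets.\<close>

lemma kirchhoff_index_eq:
  assumes "network G"
  shows "kirchhoff_index G = (\<Sum>a\<in>pverts G. resistance_sum G a) / 2"
proof -
  let ?V = "pverts G" and ?R = "resistance_distance G"
  let ?f = "\<lambda>(a, b). {a, b}" and ?S = "{(a, b). a \<in> ?V \<and> b \<in> ?V \<and> a \<noteq> b}"
  let ?P = "{p. p \<subseteq> ?V \<and> card p = 2}"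
  let ?g = "\<lambda>p. THE r. \<exists>a b. p = {a, b} \<and> r = ?R a b"
  have fin: "finite ?V" using networkD[OF assms] by blast
  have S: "?S \<subseteq> ?V \<times> ?V" by auto
  have finS: "finite ?S" using finite_subset[OF S] fin by simp
  have img: "?f ` ?S = ?P"
  proof (intro equalityI subsetI)
    fix p assume "p \<in> ?P"
    then obtain a b where "p = {a, b}" "a \<noteq> b" "a \<in> ?V" "b \<in> ?V" by (auto simp: card_2_iff)
    then show "p \<in> ?f ` ?S" by (intro image_eqI[of _ _ "(a, b)"]) auto
  qed auto
  have "(\<Sum>a\<in>?V. resistance_sum G a) = (\<Sum>(a, b)\<in>?V \<times> ?V. ?R a b)"
    by (simp add: resistance_sum_def sum.cartesian_product)
  also have "\<dots> = (\<Sum>(a, b)\<in>?S. ?R a b)"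
    using fin S by (intro sum.mono_neutral_right) (auto simp: resistance_distance_self[OF assms])
  also have "\<dots> = (\<Sum>p\<in>?f ` ?S. \<Sum>q | q \<in> ?S \<and> ?f q = p. (\<lambda>(a, b). ?R a b) q)"
    by (rule sum.image_gen[OF finS])
  also have "\<dots> = (\<Sum>p\<in>?P. 2 * ?g p)"
  proof (rule sum.cong[OF img])
    fix p assume "p \<in> ?P"
    then obtain a b where p: "p = {a, b}" "a \<noteq> b" "a \<in> ?V" "b \<in> ?V"
      by (auto simp: card_2_iff)
    have "{q \<in> ?S. ?f q = p} = {(a, b), (b, a)}"
      using p by (auto simp: doubleton_eq_iff)
    \<comment> \<open>The description is unique because both orderings of the pair give the same
      resistance.\<close>
    moreover have "?g p = ?R a b"
    proof (rule the_equality)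
      fix r assume "\<exists>x y. p = {x, y} \<and> r = ?R x y"
      then show "r = ?R a b"
        using p resistance_distance_commute[OF assms p(3,4)] by (auto simp: doubleton_eq_iff)
    qed (use p in blast)
    ultimately show "(\<Sum>q | q \<in> ?S \<and> ?f q = p. (\<lambda>(a, b). ?R a b) q) = 2 * ?g p"
      using p resistance_distance_commute[OF assms p(3,4)] by simp
  qed
  also have "\<dots> = 2 * kirchhoff_index G"
    by (simp add: kirchhoff_index_def sum_distrib_left)
  finally show ?thesis by simp
qed

section \<open>Gluing two networks at a common vertex\<close>

definition glue :: "'a pair_pre_digraph \<Rightarrow> 'a pair_pre_digraph \<Rightarrow> 'a pair_pre_digraph" where
  "glue G H = \<lparr> pverts = pverts G \<union> pverts H, parcs = parcs G \<union> parcs H \<rparr>"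

lemma glue_simps [simp]:
  "pverts (glue G H) = pverts G \<union> pverts H" "parcs (glue G H) = parcs G \<union> parcs H"
  by (simp_all add: glue_def)

lemma glue_commute: "glue G H = glue H G"
  by (simp add: glue_def Un_commute)

text \<open>Both potentials are normalised to vanish at the common vertex \<open>c\<close>.\<close>

lemma laplacian_glue:
  assumes "network G" "network H" "pverts G \<inter> pverts H = {c}" "x \<in> pverts G \<union> pverts H"
  shows "laplacian (glue G H) (\<lambda>y. if y \<in> pverts G then \<phi> y - \<phi> c else \<psi> y - \<psi> c) x =
    (if x \<in> pverts G then laplacian G \<phi> x else 0) + (if x \<in> pverts H then laplacian H \<psi> x else 0)"
    (is "laplacian _ ?\<theta> x = _")
proof -
  have G: "?\<theta> y = \<phi> y - \<phi> c" if "y \<in> pverts G" for y using that by simp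
  have H: "?\<theta> y = \<psi> y - \<psi> c" if "y \<in> pverts H" for y
  proof (cases "y \<in> pverts G")
    case True
    then have "y = c" using that assms(3) by auto
    then show ?thesis by simp
  qed simp
  have sub: "parcs G \<subseteq> pverts G \<times> pverts G" "parcs H \<subseteq> pverts H \<times> pverts H"
    using networkD(2) assms by blast+
  have fin: "finite {y. (x, y) \<in> parcs G}" "finite {y. (x, y) \<in> parcs H}"
    using sub by (auto intro: finite_subset[OF _ networkD(1)[OF assms(1)]]
        finite_subset[OF _ networkD(1)[OF assms(2)]])
  have 1: "(\<Sum>y | (x, y) \<in> parcs G. ?\<theta> x - ?\<theta> y) = (if x \<in> pverts G then laplacian G \<phi> x else 0)"
  proof (cases "x \<in> pverts G")
    case True
    have "(\<Sum>y | (x, y) \<in> parcs G. ?\<theta> x - ?\<theta> y) = (\<Sum>y | (x, y) \<in> parcs G. \<phi> x - \<phi> y)"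
      using sub True by (intro sum.cong) (auto simp: G)
    then show ?thesis using True by (simp add: laplacian_def)
  next
    case False
    then have "{y. (x, y) \<in> parcs G} = {}" using sub by auto
    then show ?thesis using False by (simp del: Collect_empty_eq)
  qed
  have 2: "(\<Sum>y | (x, y) \<in> parcs H. ?\<theta> x - ?\<theta> y) = (if x \<in> pverts H then laplacian H \<psi> x else 0)"
  proof (cases "x \<in> pverts H")
    case True
    have "(\<Sum>y | (x, y) \<in> parcs H. ?\<theta> x - ?\<theta> y) = (\<Sum>y | (x, y) \<in> parcs H. \<psi> x - \<psi> y)"
    proof (rule sum.cong[OF refl])
      fix y assume "y \<in> {y. (x, y) \<in> parcs H}"
      then have "y \<in> pverts H" using sub by auto
      then show "?\<theta> x - ?\<theta> y = \<psi> x - \<psi> y" using H[OF True] H[of y] by linarith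
    qed
    then show ?thesis using True by (simp add: laplacian_def)
  next
    case False
    then have "{y. (x, y) \<in> parcs H} = {}" using sub by auto
    then show ?thesis using False by (simp del: Collect_empty_eq)
  qed
  have "{y. (x, y) \<in> parcs G \<union> parcs H} = {y. (x, y) \<in> parcs G} \<union> {y. (x, y) \<in> parcs H}"
    by auto
  then have "laplacian (glue G H) ?\<theta> x =
      (\<Sum>y\<in>{y. (x, y) \<in> parcs G} \<union> {y. (x, y) \<in> parcs H}. ?\<theta> x - ?\<theta> y)"
    by (simp add: laplacian_def)
  \<comment> \<open>The neighbour sets may overlap only in a loop at \<open>c\<close>, whose term is
    zero.\<close>
  also have "\<dots> = (\<Sum>y | (x, y) \<in> parcs G. ?\<theta> x - ?\<theta> y) + (\<Sum>y | (x, y) \<in> parcs H. ?\<theta> x - ?\<theta> y)"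
  proof (rule sum.union_inter_neutral[OF fin], rule ballI)
    fix y assume "y \<in> {y. (x, y) \<in> parcs G} \<inter> {y. (x, y) \<in> parcs H}"
    then have "x = c" "y = c" using sub assms(3) by auto
    then show "?\<theta> x - ?\<theta> y = 0" by simp
  qed
  finally show ?thesis using 1 2 by simp
qed

text \<open>All of \<open>H\<close> is kept at the potential of \<open>c\<close>, so no current
  flows there.\<close>

lemma glue_potential_same_side:
  assumes "network G" "network H" "pverts G \<inter> pverts H = {c}" "a \<in> pverts G" "b \<in> pverts G"
    and "unit_current_potential G a b \<phi>"
  shows "unit_current_potential (glue G H) a b (\<lambda>y. if y \<in> pverts G then \<phi> y - \<phi> c else 0)"
  unfolding unit_current_potential_laplacian
proof
  fix x assume x: "x \<in> pverts (glue G H)"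
  have "laplacian H (\<lambda>_. 0) x = 0" by (simp add: laplacian_def)
  then have "laplacian (glue G H) (\<lambda>y. if y \<in> pverts G then \<phi> y - \<phi> c else 0) x
      = (if x \<in> pverts G then laplacian G \<phi> x else 0)"
    using laplacian_glue[OF assms(1-3), of x \<phi> "\<lambda>_. 0"] x by (simp cong: if_cong)
  also have "\<dots> = of_bool (x = a) - of_bool (x = b)"
    using assms(4-6) by (auto simp: unit_current_potential_laplacian)
  finally show "laplacian (glue G H) (\<lambda>y. if y \<in> pverts G then \<phi> y - \<phi> c else 0) x
      = of_bool (x = a) - of_bool (x = b)" .
qed

text \<open>At \<open>c\<close> the unit current leaving \<open>G\<close> is the one entering
  \<open>H\<close>, so source and sink cancel.\<close>

lemma glue_potential_across:
  assumes "network G" "network H" "pverts G \<inter> pverts H = {c}" "a \<in> pverts G" "b \<in> pverts H"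
    and "unit_current_potential G a c \<phi>" "unit_current_potential H c b \<psi>"
  shows "unit_current_potential (glue G H) a b
    (\<lambda>y. if y \<in> pverts G then \<phi> y - \<phi> c else \<psi> y - \<psi> c)"
proof -
  have *: "x = c" if "x \<in> pverts G" "x \<in> pverts H" for x using that assms(3) by auto
  have c: "c \<in> pverts G" "c \<in> pverts H" using assms(3) by auto
  show ?thesis
    unfolding unit_current_potential_laplacian
  proof
    fix x assume x: "x \<in> pverts (glue G H)"
    have "laplacian (glue G H) (\<lambda>y. if y \<in> pverts G then \<phi> y - \<phi> c else \<psi> y - \<psi> c) x
        = (if x \<in> pverts G then of_bool (x = a) - of_bool (x = c) else 0)
          + (if x \<in> pverts H then of_bool (x = c) - of_bool (x = b) else 0)"
      using assms(6,7) x by (simp add: laplacian_glue[OF assms(1-3)] unit_current_potential_laplacian)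
    also have "\<dots> = of_bool (x = a) - of_bool (x = b)"
      using *[of x] *[of a] *[of b] c assms(4,5) x by auto
    finally show "laplacian (glue G H) (\<lambda>y. if y \<in> pverts G then \<phi> y - \<phi> c else \<psi> y - \<psi> c) x
        = of_bool (x = a) - of_bool (x = b)" .
  qed
qed

lemma network_glue:
  assumes "network G" "network H" "pverts G \<inter> pverts H = {c}"
  shows "network (glue G H)"
proof -
  have c: "c \<in> pverts G" "c \<in> pverts H" using assms(3) by auto
  \<comment> \<open>Stated for arbitrary parts, so that it also applies with their roles
    exchanged.\<close>
  have 1: "\<exists>\<phi>. unit_current_potential (glue G H) a b \<phi>"
    if "network G" "network H" "pverts G \<inter> pverts H = {c}" "a \<in> pverts G" "b \<in> pverts G \<union> pverts H"
    for G H :: "'a pair_pre_digraph" and a b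
    using that(5)
  proof
    assume "b \<in> pverts G"
    then show ?thesis
      using glue_potential_same_side[OF that(1-4)] networkD(4)[OF that(1,4)] by blast
  next
    assume b: "b \<in> pverts H"
    have "c \<in> pverts G" "c \<in> pverts H" using that(3) by auto
    then show ?thesis
      using glue_potential_across[OF that(1-4) b] networkD(4)[OF that(1,4)] networkD(4)[OF that(2) _ b]
      by blast
  qed
  have "\<exists>\<phi>. unit_current_potential (glue G H) a b \<phi>"
    if "a \<in> pverts G \<union> pverts H" "b \<in> pverts G \<union> pverts H" for a b
    using that(1)
  proof
    assume "a \<in> pverts G" then show ?thesis using 1[OF assms] that by blast
  next
    assume "a \<in> pverts H" then show ?thesis
      using 1[OF assms(2,1)] that assms(3) by (simp add: glue_commute Un_commute Int_commute)
  qed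
  moreover have "sym (parcs G \<union> parcs H)"
    using networkD(3)[OF assms(1)] networkD(3)[OF assms(2)] by (simp add: sym_Un)
  moreover have "parcs G \<union> parcs H \<subseteq> (pverts G \<union> pverts H) \<times> (pverts G \<union> pverts H)"
    using networkD(2)[OF assms(1)] networkD(2)[OF assms(2)] by blast
  ultimately show ?thesis
    using networkD(1)[OF assms(1)] networkD(1)[OF assms(2)] by (simp add: network_def)
qed

lemma resistance_distance_glue_same_side:
  assumes "network G" "network H" "pverts G \<inter> pverts H = {c}" "a \<in> pverts G" "b \<in> pverts G"
  shows "resistance_distance (glue G H) a b = resistance_distance G a b"
proof -
  obtain \<phi> where \<phi>: "unit_current_potential G a b \<phi>"
    using networkD(4)[OF assms(1,4,5)] by blast
  show ?thesis
    using resistance_distance_eqI[OF network_glue[OF assms(1-3)] _ _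
        glue_potential_same_side[OF assms \<phi>]] resistance_distance_eqI[OF assms(1,4,5) \<phi>] assms(4,5)
    by simp
qed

lemma resistance_distance_glue_across:
  assumes "network G" "network H" "pverts G \<inter> pverts H = {c}" "a \<in> pverts G" "b \<in> pverts H"
  shows "resistance_distance (glue G H) a b = resistance_distance G a c + resistance_distance H c b"
proof -
  have c: "c \<in> pverts G" "c \<in> pverts H" using assms(3) by auto
  obtain \<phi> where \<phi>: "unit_current_potential G a c \<phi>"
    using networkD(4)[OF assms(1,4) c(1)] by blast
  obtain \<psi> where \<psi>: "unit_current_potential H c b \<psi>"
    using networkD(4)[OF assms(2) c(2) assms(5)] by blast
  \<comment> \<open>If \<open>b\<close> also lies in \<open>G\<close>, the combined potential uses
    its first branch at \<open>b\<close>; then \<open>b = c\<close>, where both branches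
    vanish.\<close>
  have "b = c" if "b \<in> pverts G" using that assms(3,5) by auto
  then show ?thesis
    using resistance_distance_eqI[OF network_glue[OF assms(1-3)] _ _
        glue_potential_across[OF assms \<phi> \<psi>]] resistance_distance_eqI[OF assms(1,4) c(1) \<phi>]
      resistance_distance_eqI[OF assms(2) c(2) assms(5) \<psi>] assms(4,5)
    by auto
qed

text \<open>Every vertex of \<open>H\<close> other than \<open>c\<close> is reached through
  \<open>c\<close> and pays the resistance from \<open>a\<close> to \<open>c\<close> once;
  \<open>c\<close> itself is counted in \<open>G\<close>, hence the \<open>- 1\<close>.\<close>

lemma resistance_sum_glue:
  assumes "network G" "network H" "pverts G \<inter> pverts H = {c}" "a \<in> pverts G"
  shows "resistance_sum (glue G H) a = resistance_sum G a
    + (real (card (pverts H)) - 1) * resistance_distance G a c + resistance_sum H c"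
proof -
  have c: "c \<in> pverts G" "c \<in> pverts H" using assms(3) by auto
  have fin: "finite (pverts G)" "finite (pverts H)" using networkD(1) assms(1,2) by blast+
  have "pverts G \<union> pverts H = pverts G \<union> (pverts H - {c})" using c by auto
  moreover have "pverts G \<inter> (pverts H - {c}) = {}" using assms(3) by auto
  ultimately have "resistance_sum (glue G H) a = (\<Sum>x\<in>pverts G. resistance_distance (glue G H) a x)
      + (\<Sum>x\<in>pverts H - {c}. resistance_distance (glue G H) a x)"
    unfolding resistance_sum_def using fin by (simp add: sum.union_disjoint)
  also have "(\<Sum>x\<in>pverts G. resistance_distance (glue G H) a x) = resistance_sum G a"
    unfolding resistance_sum_def
    by (intro sum.cong refl resistance_distance_glue_same_side[OF assms])
  also have "(\<Sum>x\<in>pverts H - {c}. resistance_distance (glue G H) a x)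
      = (\<Sum>x\<in>pverts H - {c}. resistance_distance G a c + resistance_distance H c x)"
    by (intro sum.cong refl resistance_distance_glue_across[OF assms]) auto
  also have "\<dots> = real (card (pverts H - {c})) * resistance_distance G a c + resistance_sum H c"
    using c fin resistance_distance_self[OF assms(2) c(2)]
    by (simp add: sum.distrib sum_diff1 resistance_sum_def)
  also have "real (card (pverts H - {c})) = real (card (pverts H)) - 1"
    using c fin by (simp add: card_Suc_Diff1[symmetric, of "pverts H" c] del: card_Diff_insert)
  finally show ?thesis by simp
qed

text \<open>Apart from the pairs inside a part, there are the pairs across, whose resistance splits
  at \<open>c\<close>; each summand is repeated once for every vertex of the opposite part other
  than \<open>c\<close>.\<close>

lemma kirchhoff_index_glue:
  assumes "network G" "network H" "pverts G \<inter> pverts H = {c}"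
  shows "kirchhoff_index (glue G H) = kirchhoff_index G + kirchhoff_index H
    + (real (card (pverts H)) - 1) * resistance_sum G c
    + (real (card (pverts G)) - 1) * resistance_sum H c"
proof -
  have c: "c \<in> pverts G" "c \<in> pverts H" using assms(3) by auto
  have fin: "finite (pverts G)" "finite (pverts H)" using networkD(1) assms(1,2) by blast+
  have swap: "pverts H \<inter> pverts G = {c}" using assms(3) by auto
  have R: "(\<Sum>a\<in>pverts K. resistance_distance K a c) = resistance_sum K c"
    if "network K" "c \<in> pverts K" for K
    unfolding resistance_sum_def using resistance_distance_commute[OF that(1) _ that(2)]
    by (intro sum.cong) auto
  have "pverts G \<union> pverts H = pverts G \<union> (pverts H - {c})" using c by auto
  moreover have "pverts G \<inter> (pverts H - {c}) = {}" using assms(3) by auto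
  \<comment> \<open>For vertices of \<open>H\<close> the composite is read as
    \<open>glue H G\<close>, since \<open>resistance_sum_glue\<close> starts in the first
    part.\<close>
  ultimately have "2 * kirchhoff_index (glue G H) = (\<Sum>a\<in>pverts G. resistance_sum (glue G H) a)
      + (\<Sum>a\<in>pverts H - {c}. resistance_sum (glue H G) a)"
    using fin by (simp add: kirchhoff_index_eq[OF network_glue[OF assms]] sum.union_disjoint
        glue_commute)
  also have "(\<Sum>a\<in>pverts G. resistance_sum (glue G H) a) = 2 * kirchhoff_index G
      + (real (card (pverts H)) - 1) * resistance_sum G c + card (pverts G) * resistance_sum H c"
    by (simp add: resistance_sum_glue[OF assms] sum.distrib sum_distrib_left[symmetric] R assms c
        kirchhoff_index_eq)
  also have "(\<Sum>a\<in>pverts H - {c}. resistance_sum (glue H G) a)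
      = (\<Sum>a\<in>pverts H. resistance_sum (glue H G) a) - resistance_sum (glue H G) c"
    using fin c by (simp add: sum_diff1)
  also have "(\<Sum>a\<in>pverts H. resistance_sum (glue H G) a) = 2 * kirchhoff_index H
      + (real (card (pverts G)) - 1) * resistance_sum H c + card (pverts H) * resistance_sum G c"
    by (simp add: resistance_sum_glue[OF assms(2,1) swap] sum.distrib sum_distrib_left[symmetric] R
        assms c kirchhoff_index_eq)
  also have "resistance_sum (glue H G) c = resistance_sum H c + resistance_sum G c"
    by (simp add: resistance_sum_glue[OF assms(2,1) swap c(2)] resistance_distance_self[OF assms(2) c(2)])
  finally show ?thesis by (simp add: algebra_simps)
qed

section \<open>Invariance under relabelling\<close>

definition relabel :: "('a \<Rightarrow> 'b) \<Rightarrow> 'a pair_pre_digraph \<Rightarrow> 'b pair_pre_digraph" where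
  "relabel f G = \<lparr> pverts = f ` pverts G, parcs = map_prod f f ` parcs G \<rparr>"

lemma relabel_simps [simp]:
  "pverts (relabel f G) = f ` pverts G" "parcs (relabel f G) = map_prod f f ` parcs G"
  by (simp_all add: relabel_def)

text \<open>Injectivity is asked only on the vertex set: the identification map is injective on each
  of the three parts but not on their union.\<close>

lemma relabel_potential:
  assumes "network G" "inj_on f (pverts G)" "a \<in> pverts G" "b \<in> pverts G"
    and "unit_current_potential G a b \<phi>"
  shows "unit_current_potential (relabel f G) (f a) (f b) (\<phi> \<circ> inv_into (pverts G) f)"
  unfolding unit_current_potential_def
proof
  fix x' assume "x' \<in> pverts (relabel f G)"
  then obtain x where x: "x \<in> pverts G" "x' = f x" by auto
  have sub: "parcs G \<subseteq> pverts G \<times> pverts G" using networkD(2)[OF assms(1)] .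
  have inj: "f y = f z \<longleftrightarrow> y = z" if "y \<in> pverts G" "z \<in> pverts G" for y z
    using assms(2) that by (auto dest: inj_onD)
  have "{y'. (x', y') \<in> parcs (relabel f G)} = f ` {y. (x, y) \<in> parcs G}"
  proof (intro equalityI subsetI)
    fix y' assume "y' \<in> {y'. (x', y') \<in> parcs (relabel f G)}"
    then obtain w y where "(w, y) \<in> parcs G" "f w = f x" "y' = f y" using x by auto
    moreover then have "w = x" using sub x inj[of w x] by auto
    ultimately show "y' \<in> f ` {y. (x, y) \<in> parcs G}" by auto
  qed (use x in auto)
  moreover have "inj_on f {y. (x, y) \<in> parcs G}"
    using assms(2) by (rule inj_on_subset) (use sub in auto)
  ultimately have "(\<Sum>y' | (x', y') \<in> parcs (relabel f G).
      (\<phi> \<circ> inv_into (pverts G) f) x' - (\<phi> \<circ> inv_into (pverts G) f) y')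
      = (\<Sum>y | (x, y) \<in> parcs G. (\<phi> \<circ> inv_into (pverts G) f) (f x) - (\<phi> \<circ> inv_into (pverts G) f) (f y))"
    using x by (simp add: sum.reindex)
  also have "\<dots> = (\<Sum>y | (x, y) \<in> parcs G. \<phi> x - \<phi> y)"
    using sub assms(2) by (intro sum.cong) auto
  also have "\<dots> = of_bool (x' = f a) - of_bool (x' = f b)"
    using assms(3-5) x inj by (simp add: unit_current_potential_def)
  finally show "(\<Sum>y' | (x', y') \<in> parcs (relabel f G).
      (\<phi> \<circ> inv_into (pverts G) f) x' - (\<phi> \<circ> inv_into (pverts G) f) y')
      = of_bool (x' = f a) - of_bool (x' = f b)" .
qed

lemma network_relabel:
  assumes "network G" "inj_on f (pverts G)"
  shows "network (relabel f G)"
proof -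
  have "sym (map_prod f f ` parcs G)"
  proof (rule symI)
    fix x y assume "(x, y) \<in> map_prod f f ` parcs G"
    then obtain v w where "(v, w) \<in> parcs G" "x = f v" "y = f w" by auto
    then show "(y, x) \<in> map_prod f f ` parcs G"
      using networkD(3)[OF assms(1)] by (auto dest: symD intro!: image_eqI[of _ _ "(w, v)"])
  qed
  moreover have "\<exists>\<phi>. unit_current_potential (relabel f G) (f a) (f b) \<phi>"
    if "a \<in> pverts G" "b \<in> pverts G" for a b
    using networkD(4)[OF assms(1) that] relabel_potential[OF assms that] by blast
  moreover have "map_prod f f ` parcs G \<subseteq> f ` pverts G \<times> f ` pverts G"
    using networkD(2)[OF assms(1)] by auto
  ultimately show ?thesis
    using networkD(1)[OF assms(1)] by (simp add: network_def)
qed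

lemma resistance_distance_relabel:
  assumes "network G" "inj_on f (pverts G)" "a \<in> pverts G" "b \<in> pverts G"
  shows "resistance_distance (relabel f G) (f a) (f b) = resistance_distance G a b"
proof -
  obtain \<phi> where \<phi>: "unit_current_potential G a b \<phi>"
    using networkD(4)[OF assms(1,3,4)] by blast
  show ?thesis
    using resistance_distance_eqI[OF network_relabel[OF assms(1,2)] _ _ relabel_potential[OF assms \<phi>]]
      resistance_distance_eqI[OF assms(1,3,4) \<phi>] assms(2-4) by simp
qed

lemma resistance_sum_relabel:
  assumes "network G" "inj_on f (pverts G)" "a \<in> pverts G"
  shows "resistance_sum (relabel f G) (f a) = resistance_sum G a"
  using assms(2) by (simp add: resistance_sum_def sum.reindex resistance_distance_relabel[OF assms])

lemma kirchhoff_index_relabel: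
  assumes "network G" "inj_on f (pverts G)"
  shows "kirchhoff_index (relabel f G) = kirchhoff_index G"
  using assms(2) by (simp add: kirchhoff_index_eq assms network_relabel sum.reindex
      resistance_sum_relabel[OF assms])

section \<open>Series composition\<close>

text \<open>A network with terminals \<open>a\<close> and \<open>b\<close>, together with data that determine those of a series
  composition: order, resistance between the terminals, the resistance sums of the two terminals,
  and the Kirchhoff index.\<close>

definition two_terminal ::
  "'a pair_pre_digraph \<Rightarrow> 'a \<Rightarrow> 'a \<Rightarrow> real \<Rightarrow> real \<Rightarrow> real \<Rightarrow> real \<Rightarrow> real \<Rightarrow> bool" where
  "two_terminal G a b n r p q k \<longleftrightarrow> network G \<and> a \<in> pverts G \<and> b \<in> pverts G \<and>
     real (card (pverts G)) = n \<and> resistance_distance G a b = r \<and>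
     resistance_sum G a = p \<and> resistance_sum G b = q \<and> kirchhoff_index G = k"

lemma two_terminal_reverse:
  "two_terminal G a b n r p q k \<Longrightarrow> two_terminal G b a n r q p k"
  using resistance_distance_commute[of G a b] by (auto simp: two_terminal_def)

lemma two_terminal_relabel:
  assumes "two_terminal G a b n r p q k" "inj_on f (pverts G)"
  shows "two_terminal (relabel f G) (f a) (f b) n r p q k"
  using assms by (auto simp: two_terminal_def network_relabel resistance_distance_relabel
      resistance_sum_relabel kirchhoff_index_relabel card_image)

text \<open>The new data enter through equations, so that closed forms can be proposed and only
  polynomial identities remain to be checked.\<close>

lemma two_terminal_glue:
  assumes G: "two_terminal G a b n r p q k" and H: "two_terminal H b c n' r' p' q' k'"
    and meet: "pverts G \<inter> pverts H = {b}"
    and data: "N = n + n' - 1" "R = r + r'" "P = p + (n' - 1) * r + p'" "Q = q' + (n - 1) * r' + q"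
      "K = k + k' + (n' - 1) * q + (n - 1) * p'"
  shows "two_terminal (glue G H) a c N R P Q K"
proof -
  have nets: "network G" "network H" and mem: "a \<in> pverts G" "c \<in> pverts H" "b \<in> pverts H"
    using G H by (auto simp: two_terminal_def)
  have meet': "pverts H \<inter> pverts G = {b}" using meet by auto
  have "card (pverts G) + card (pverts H) = card (pverts G \<union> pverts H) + 1"
    using card_Un_Int[OF networkD(1)[OF nets(1)] networkD(1)[OF nets(2)]] meet by simp
  then have "real (card (pverts G \<union> pverts H)) = n + n' - 1"
    using G H by (simp add: two_terminal_def)
  moreover have "resistance_sum (glue G H) c = q' + (n - 1) * r' + q"
    using resistance_sum_glue[OF nets(2,1) meet' mem(2)] G H resistance_distance_commute[OF nets(2) mem(2,3)]
    by (simp add: two_terminal_def glue_commute)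
  ultimately show ?thesis
    using G H by (simp add: two_terminal_def data network_glue[OF nets meet]
        resistance_distance_glue_across[OF nets meet mem(1,2)] resistance_sum_glue[OF nets meet mem(1)]
        kirchhoff_index_glue[OF nets meet])
qed

section \<open>Cliques, triangle chains and paths\<close>

definition clique :: "'a set \<Rightarrow> 'a pair_pre_digraph" where
  "clique V = \<lparr> pverts = V, parcs = {(x, y). x \<in> V \<and> y \<in> V \<and> x \<noteq> y} \<rparr>"

lemma clique_simps [simp]:
  "pverts (clique V) = V" "parcs (clique V) = {(x, y). x \<in> V \<and> y \<in> V \<and> x \<noteq> y}"
  by (simp_all add: clique_def)

text \<open>On functions with sum zero the Laplacian of a complete graph is multiplication by
  \<open>card V\<close>, so the prescribed current is divided by \<open>card V\<close>.\<close>

lemma clique_potential: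
  assumes "finite V" "a \<in> V" "b \<in> V"
  shows "unit_current_potential (clique V) a b (\<lambda>x. (of_bool (x = a) - of_bool (x = b)) / card V)"
  unfolding unit_current_potential_def
proof
  let ?\<phi> = "\<lambda>x. (of_bool (x = a) - of_bool (x = b)) / real (card V)"
  fix x assume "x \<in> pverts (clique V)"
  then have x: "x \<in> V" by simp
  have card: "card V > 0" using assms by (auto simp: card_gt_0_iff)
  have "(\<Sum>y\<in>V. ?\<phi> y) = ((\<Sum>y\<in>V. of_bool (y = a)) - (\<Sum>y\<in>V. of_bool (y = b))) / real (card V)"
    by (simp add: sum_subtractf sum_divide_distrib[symmetric])
  also have "\<dots> = 0" using assms by (simp add: of_bool_def)
  finally have 0: "(\<Sum>y\<in>V. ?\<phi> y) = 0" .
  have "{y. (x, y) \<in> parcs (clique V)} = V - {x}" using x by auto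
  then have "(\<Sum>y | (x, y) \<in> parcs (clique V). ?\<phi> x - ?\<phi> y) = (\<Sum>y\<in>V - {x}. ?\<phi> x - ?\<phi> y)"
    by simp
  also have "\<dots> = (\<Sum>y\<in>V. ?\<phi> x - ?\<phi> y)"
    using assms(1) x by (subst sum_diff1) auto
  also have "\<dots> = card V * ?\<phi> x" using 0 by (simp add: sum_subtractf)
  also have "\<dots> = of_bool (x = a) - of_bool (x = b)" using card by simp
  finally show "(\<Sum>y | (x, y) \<in> parcs (clique V). ?\<phi> x - ?\<phi> y) = of_bool (x = a) - of_bool (x = b)" .
qed

text \<open>One computation covers the single vertex, the edge and the triangle. The case
  \<open>a = b\<close> serves the one-vertex graph, whose two terminals coincide.\<close>

lemma two_terminal_clique:
  assumes "finite V" "a \<in> V" "b \<in> V" and n: "n = real (card V)"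
  shows "two_terminal (clique V) a b n (if a = b then 0 else 2 / n) (2 * (n - 1) / n) (2 * (n - 1) / n)
    (n - 1)"
proof -
  have net: "network (clique V)"
    using assms(1) clique_potential[OF assms(1)] by (auto simp: network_def sym_def)
  have R: "resistance_distance (clique V) x y = (if x = y then 0 else 2 / n)" if "x \<in> V" "y \<in> V" for x y
    using resistance_distance_eqI[OF net _ _ clique_potential[OF assms(1) that]] that n
    by (auto simp: field_simps)
  have S: "resistance_sum (clique V) x = 2 * (n - 1) / n" if "x \<in> V" for x
  proof -
    have "resistance_sum (clique V) x = (\<Sum>y\<in>V. 2 / n - (if x = y then 2 / n else 0))"
      unfolding resistance_sum_def using that by (intro sum.cong) (auto simp: R)
    also have "\<dots> = n * (2 / n) - 2 / n"
      using assms(1) n that by (simp add: sum_subtractf)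
    finally show ?thesis by (simp add: diff_divide_distrib algebra_simps)
  qed
  have "n > 0" using assms by (auto simp: card_gt_0_iff)
  then have "kirchhoff_index (clique V) = n - 1"
    by (simp add: kirchhoff_index_eq[OF net] S n[symmetric])
  then show ?thesis
    using net R S assms by (simp add: two_terminal_def)
qed

text \<open>The first terminal stays fixed while the second moves on. The condition
  \<open>c \<noteq> b\<close> keeps consecutive joints distinct, so that no vertex lies in three
  triangles.\<close>

inductive triangle_chain :: "nat \<Rightarrow> 'a \<Rightarrow> 'a \<Rightarrow> 'a pair_pre_digraph \<Rightarrow> bool" where
  vertex: "triangle_chain 0 a a (clique {a})"
| triangle: "triangle_chain (Suc j) a c (glue G (clique T))"
  if "triangle_chain j a b G" "card T = 3" "pverts G \<inter> T = {b}" "c \<in> T" "c \<noteq> b"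

text \<open>Closed forms of the recurrences obtained by gluing on a triangle with data 3, 2/3, 4/3,
  4/3, 2. Each triangle adds 2/3 to the terminal resistance.\<close>

lemma two_terminal_triangle_chain:
  assumes "triangle_chain j a b G"
  shows "two_terminal G a b (2 * real j + 1) (2 / 3 * real j) (2 / 3 * real j * (real j + 1))
    (2 / 3 * real j * (real j + 1)) (2 / 9 * real j * (real j - 1) * (2 * real j - 1) + 2 * real j ^ 2)"
  using assms
proof induction
  case (vertex a)
  show ?case using two_terminal_clique[of "{a}" a a 1] by simp
next
  case (triangle j a b G T c)
  have "finite T" using triangle(2) card_ge_0_finite[of T] by simp
  moreover have "b \<in> T" using triangle(3) by auto
  ultimately have T: "two_terminal (clique T) b c 3 (2 / 3) (4 / 3) (4 / 3) 2"
    using two_terminal_clique[of T b c 3] triangle(2,4,5) by simp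
  show ?case
    by (rule two_terminal_glue[OF triangle.IH T])
      (use triangle(3) in \<open>simp_all add: field_simps power2_eq_square\<close>)
qed

lemma path_graph_Suc_Suc: "path_graph (Suc (Suc s)) = glue (path_graph (Suc s)) (clique {Suc s, Suc (Suc s)})"
  by (auto simp: path_graph_def glue_def)

text \<open>The shift makes \<open>s\<close> the number of edges. Resistances in a path are
  distances, so the last entry is the Wiener index, the binomial coefficient of \<open>s + 2\<close>
  over 3.\<close>

lemma two_terminal_path_graph:
  "two_terminal (path_graph (Suc s)) 1 (Suc s) (real s + 1) (real s) (real s * (real s + 1) / 2)
    (real s * (real s + 1) / 2) (real s * (real s + 1) * (real s + 2) / 6)"
proof (induction s)
  case 0
  have "path_graph (Suc 0) = clique {1}" by (auto simp: path_graph_def clique_def)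
  then show ?case using two_terminal_clique[of "{1::nat}" 1 1 1] by simp
next
  case (Suc s)
  have "two_terminal (clique {Suc s, Suc (Suc s)}) (Suc s) (Suc (Suc s)) 2 1 1 1 1"
    using two_terminal_clique[of "{Suc s, Suc (Suc s)}" "Suc s" "Suc (Suc s)" 2] by simp
  moreover have "pverts (path_graph (Suc s)) \<inter> pverts (clique {Suc s, Suc (Suc s)}) = {Suc s}"
    by (auto simp: path_graph_def)
  ultimately show ?case
    unfolding path_graph_Suc_Suc by (rule two_terminal_glue[OF Suc.IH]) (simp_all add: field_simps)
qed

section \<open>The graph C_{n,t} as a series composition\<close>

lemma identify_eq_relabel:
  "identify r G = relabel (\<lambda>x. (r \<union> r\<inverse>)\<^sup>* `` {x}) G"
  by (simp add: identify_def relabel_def Let_def)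

lemma relabel_disjoint_union:
  "relabel f (disjoint_union G H) = glue (relabel (f \<circ> Inl) G) (relabel (f \<circ> Inr) H)"
  by (simp add: relabel_def disjoint_union_def glue_def Plus_def image_Un image_comp map_prod.comp)

text \<open>The generated equivalence is the kernel of any function that picks representatives.\<close>

lemma equivalence_class_eq_iff:
  assumes "\<And>x y. (x, y) \<in> r \<Longrightarrow> f x = f y" and "\<And>x. (x, f x) \<in> (r \<union> r\<inverse>)\<^sup>*"
  shows "(r \<union> r\<inverse>)\<^sup>* `` {x} = (r \<union> r\<inverse>)\<^sup>* `` {y} \<longleftrightarrow> f x = f y"
proof -
  have 1: "f v = f w" if "(v, w) \<in> (r \<union> r\<inverse>)\<^sup>*" for v w
    using that by induction (use assms(1) in auto)
  have "sym ((r \<union> r\<inverse>)\<^sup>*)" by (simp add: sym_rtrancl sym_Un_converse)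
  then have 2: "(v, w) \<in> (r \<union> r\<inverse>)\<^sup>*" if "f v = f w" for v w
    using that assms(2)[of v] assms(2)[of w] by (metis rtrancl_trans symD)
  have "(r \<union> r\<inverse>)\<^sup>* `` {v} = {w. f v = f w}" for v
    using 1 2 by blast
  then show ?thesis by auto
qed

text \<open>The path is glued to \<open>B\<close> first and \<open>A\<close> is attached afterwards.
  The far terminals \<open>a\<close> and \<open>b\<close> leave no trace in the result.\<close>

lemma two_terminal_C_graph:
  assumes A: "two_terminal A u a n1 r1 p1 q1 k1"
    and P: "two_terminal (path_graph s) 1 s n2 r2 p2 q2 k2"
    and B: "two_terminal B v b n3 r3 p3 q3 k3"
    and s: "s = n - 2 * t" "s \<ge> 1"
  shows "kirchhoff_index (C_graph n t A u B v) = k1 + (k2 + k3 + (n3 - 1) * q2 + (n2 - 1) * p3)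
    + (n2 + n3 - 2) * p1 + (n1 - 1) * (p2 + (n3 - 1) * r2 + p3)"
proof -
  let ?r = "{(Inl u, Inr (Inl 1)), (Inr (Inr v), Inr (Inl s))} :: ('a + nat + 'b) rel"
  \<comment> \<open>Representatives are chosen on the path. For \<open>s = 1\<close> both attachment
    vertices go to the same path vertex, so this case needs no separate treatment.\<close>
  define rep :: "'a + nat + 'b \<Rightarrow> 'a + nat + 'b" where
    "rep x = (if x = Inl u then Inr (Inl 1) else if x = Inr (Inr v) then Inr (Inl s) else x)" for x
  define cls where "cls = (\<lambda>x. (?r \<union> ?r\<inverse>)\<^sup>* `` {x})"
  have cls: "cls x = cls y \<longleftrightarrow> rep x = rep y" for x y
    unfolding cls_def by (rule equivalence_class_eq_iff) (auto simp: rep_def)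
  have mem: "u \<in> pverts A" "v \<in> pverts B" using A B by (auto simp: two_terminal_def)
  have pverts: "pverts (path_graph s) = {1..s}" by (simp add: path_graph_def)
  define A' where "A' = relabel (cls \<circ> Inl) A"
  define P' where "P' = relabel (cls \<circ> (Inr \<circ> Inl)) (path_graph s)"
  define B' where "B' = relabel (cls \<circ> (Inr \<circ> Inr)) B"
  have C: "C_graph n t A u B v = glue A' (glue P' B')"
    by (simp add: C_graph_def Let_def identify_eq_relabel relabel_disjoint_union A'_def P'_def B'_def
        cls_def s(1)[symmetric] comp_assoc)
  have "inj_on (cls \<circ> Inl) (pverts A)"
    by (auto simp: inj_on_def cls rep_def split: if_splits)
  \<comment> \<open>\<open>A\<close> is reversed so that \<open>u\<close> becomes the terminal
    facing the path.\<close>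
  then have A': "two_terminal A' (cls (Inl a)) (cls (Inl u)) n1 r1 q1 p1 k1"
    unfolding A'_def using two_terminal_relabel[OF two_terminal_reverse[OF A], of "cls \<circ> Inl"] by simp
  have "inj_on (cls \<circ> (Inr \<circ> Inl)) (pverts (path_graph s))"
    by (auto simp: inj_on_def cls rep_def split: if_splits)
  then have "two_terminal P' (cls (Inr (Inl 1))) (cls (Inr (Inl s))) n2 r2 p2 q2 k2"
    unfolding P'_def using two_terminal_relabel[OF P, of "cls \<circ> (Inr \<circ> Inl)"] by simp
  then have P': "two_terminal P' (cls (Inl u)) (cls (Inr (Inr v))) n2 r2 p2 q2 k2"
    using cls[of "Inl u" "Inr (Inl 1)"] cls[of "Inr (Inr v)" "Inr (Inl s)"] by (simp add: rep_def)
  have "inj_on (cls \<circ> (Inr \<circ> Inr)) (pverts B)"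
    by (auto simp: inj_on_def cls rep_def split: if_splits)
  then have B': "two_terminal B' (cls (Inr (Inr v))) (cls (Inr (Inr b))) n3 r3 p3 q3 k3"
    unfolding B'_def using two_terminal_relabel[OF B, of "cls \<circ> (Inr \<circ> Inr)"] by simp
  have PB: "pverts P' \<inter> pverts B' = {cls (Inr (Inr v))}"
  proof -
    have "w = v" if "cls (Inr (Inl i)) = cls (Inr (Inr w))" for i w
      using that by (auto simp: cls rep_def split: if_splits)
    moreover have "cls (Inr (Inr v)) = cls (Inr (Inl s))" by (simp add: cls rep_def)
    ultimately show ?thesis
      using mem s(2) by (auto simp: P'_def B'_def pverts)
  qed
  have AP: "pverts A' \<inter> pverts (glue P' B') = {cls (Inl u)}"
  proof -
    have "x = cls (Inl u)" if "x \<in> pverts A'" "x \<in> pverts (glue P' B')" for x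
    proof -
      obtain w z where "x = cls (Inl w)" "x = cls (Inr z)"
        using \<open>x \<in> pverts A'\<close> \<open>x \<in> pverts (glue P' B')\<close> by (auto simp: A'_def P'_def B'_def)
      then show ?thesis by (auto simp: cls rep_def split: if_splits)
    qed
    moreover have "cls (Inl u) \<in> pverts A'" using mem by (simp add: A'_def)
    moreover have "cls (Inl u) = cls (Inr (Inl 1))" by (simp add: cls rep_def)
    then have "cls (Inl u) \<in> pverts (glue P' B')" using s(2) by (auto simp: P'_def pverts)
    ultimately show ?thesis by blast
  qed
  show ?thesis
    using two_terminal_glue[OF A' two_terminal_glue[OF P' B' PB refl refl refl refl refl] AP
        refl refl refl refl refl]
    by (simp add: C two_terminal_def)
qed

lemma kirchhoff_index_C_graph_triangle_chains:
  assumes "n \<ge> 1" "t \<le> (n - 1) div 2"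
    and A: "triangle_chain (t div 2) u a A" and B: "triangle_chain (t - t div 2) v b B"
  shows "kirchhoff_index (C_graph n t A u B v) =
    (if even t
     then 1 / 18 * (3 * real n ^ 3 - 3 * real n - 12 * real n * real t ^ 2 - 6 * real n * real t
                    + 8 * real t ^ 3 + 12 * real t ^ 2 - 2 * real t)
     else 1 / 18 * (3 * real n ^ 3 - 15 * real n - 12 * real n * real t ^ 2 - 6 * real n * real t
                    + 8 * real t ^ 3 + 12 * real t ^ 2 + 22 * real t + 12))"
proof -
  \<comment> \<open>The bound on \<open>t\<close> makes \<open>n - 2 * t\<close> positive, so the
    truncated subtraction is exact; the new \<open>s\<close> counts the edges of the path.\<close>
  obtain s where s: "n - 2 * t = Suc s" "n = 2 * t + Suc s"
    using assms(1,2) by (intro that[of "n - 2 * t - 1"]) auto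
  note K = two_terminal_C_graph[OF two_terminal_triangle_chain[OF A] two_terminal_path_graph[of s]
      two_terminal_triangle_chain[OF B] s(1)[symmetric]]
  show ?thesis
  proof (cases "even t")
    case True
    then obtain k where k: "t = 2 * k" by blast
    have "t div 2 = k" "t - t div 2 = k" using k by auto
    with K k show ?thesis
      by (simp add: s(2) field_simps power2_eq_square power3_eq_cube)
  next
    case False
    then obtain k where k: "t = 2 * k + 1" using oddE by blast
    have "t div 2 = k" "t - t div 2 = k + 1" using k by auto
    with K k show ?thesis
      by (simp add: s(2) field_simps power2_eq_square power3_eq_cube)
  qed
qed

section \<open>Chains of triangles\<close>

definition triangle_union :: "'a set set \<Rightarrow> 'a pair_pre_digraph" where
  "triangle_union \<T> = \<lparr> pverts = \<Union>\<T>, parcs = (\<Union>T\<in>\<T>. parcs (clique T)) \<rparr>"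

lemma pverts_triangle_union [simp]: "pverts (triangle_union \<T>) = \<Union>\<T>"
  by (simp add: triangle_union_def)

lemma triangle_union_insert: "triangle_union (insert T \<T>) = glue (triangle_union \<T>) (clique T)"
  by (simp add: triangle_union_def glue_def Un_commute)

text \<open>The combinatorial core, stated for a family of three-element sets. Connectedness says
  that no proper nonempty subfamily is separated from the rest. That triangles meet in at most one
  vertex is not assumed; it follows while the chain grows.\<close>

lemma triangle_chain_of_triangles:
  fixes \<T> :: "'a set set"
  defines "shared \<equiv> \<lambda>T. {x \<in> T. \<exists>T'\<in>\<T>. T' \<noteq> T \<and> x \<in> T'}"
  assumes fin: "finite \<T>" and three: "\<And>T. T \<in> \<T> \<Longrightarrow> card T = 3"
    and at_most_two: "\<And>x T T' T''. \<lbrakk>T \<in> \<T>; T' \<in> \<T>; T'' \<in> \<T>; x \<in> T; x \<in> T'; x \<in> T''; T \<noteq> T'\<rbrakk>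
      \<Longrightarrow> T'' = T \<or> T'' = T'"
    and shared: "\<And>T. T \<in> \<T> \<Longrightarrow> card (shared T) \<le> 2"
    and T1: "T1 \<in> \<T>" "card (shared T1) \<le> 1" "u \<in> T1" "u \<notin> shared T1"
    and conn: "\<And>\<S>. \<lbrakk>\<S> \<subseteq> \<T>; \<S> \<noteq> {}; \<S> \<noteq> \<T>\<rbrakk> \<Longrightarrow> \<exists>T\<in>\<T> - \<S>. T \<inter> \<Union>\<S> \<noteq> {}"
  shows "\<exists>b. triangle_chain (card \<T>) u b (triangle_union \<T>)"
proof -
  have finT: "finite T" if "T \<in> \<T>" for T using three[OF that] card_ge_0_finite by force
  have fin_shared: "finite (shared T)" if "T \<in> \<T>" for T
    using finT[OF that] by (simp add: shared_def)
  \<comment> \<open>Grow the chain from \<open>T1\<close>: \<open>T\<close> is its last triangle, entered at \<open>e\<close>, and only the other two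
    vertices of \<open>T\<close> may lie on triangles outside \<open>\<S>\<close>.\<close>
  have grow: "\<exists>\<S> T e. \<S> \<subseteq> \<T> \<and> card \<S> = Suc i \<and> T \<in> \<S> \<and> e \<in> T \<and> card (shared T - {e}) \<le> 1 \<and>
      (\<forall>z\<in>T - {e}. triangle_chain (Suc i) u z (triangle_union \<S>)) \<and>
      (\<forall>T'\<in>\<T> - \<S>. T' \<inter> \<Union>\<S> \<subseteq> T - {e})"
    if "i < card \<T>" for i
    using that
  proof (induction i)
    case 0
    \<comment> \<open>The first triangle is glued to the one-vertex chain at \<open>u\<close>, which
      thereby counts as its entry.\<close>
    have "glue (clique {u}) (clique T1) = triangle_union {T1}"
      using T1(3) by (auto simp: triangle_union_def glue_def clique_def)
    then have "triangle_chain (Suc 0) u z (triangle_union {T1})" if "z \<in> T1 - {u}" for z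
      using triangle_chain.triangle[OF triangle_chain.vertex[of u], of T1 z] three T1(1,3) that by auto
    moreover have "T' \<inter> \<Union>{T1} \<subseteq> T1 - {u}" if "T' \<in> \<T> - {T1}" for T'
      using that T1(3,4) by (auto simp: shared_def)
    moreover have "card (shared T1 - {u}) \<le> 1"
      using T1(2,4) by simp
    ultimately show ?case
      using T1(1,3) by (intro exI[of _ "{T1}"] exI[of _ T1] exI[of _ u]) auto
  next
    case (Suc i)
    then obtain \<S> T e where IH: "\<S> \<subseteq> \<T>" "card \<S> = Suc i" "T \<in> \<S>" "e \<in> T" "card (shared T - {e}) \<le> 1"
      and chain: "\<And>z. z \<in> T - {e} \<Longrightarrow> triangle_chain (Suc i) u z (triangle_union \<S>)"
      and outside: "\<And>T'. T' \<in> \<T> - \<S> \<Longrightarrow> T' \<inter> \<Union>\<S> \<subseteq> T - {e}"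
      by (metis Suc_lessD)
    have "\<S> \<noteq> \<T>" using IH(2) Suc.prems by auto
    then obtain T' x where T': "T' \<in> \<T>" "T' \<notin> \<S>" "x \<in> T'" "x \<in> \<Union>\<S>"
      using conn[OF IH(1)] IH(3) by blast
    have T: "T \<in> \<T>" "T' \<noteq> T" using IH(1,3) T'(2) by auto
    have x: "x \<in> T" "x \<noteq> e" using outside[of T'] T' by auto
    have "x \<in> shared T - {e}" using x T' T by (auto simp: shared_def)
    then have only_x: "shared T - {e} = {x}"
      using IH(5) card_le_Suc0_iff_eq[of "shared T - {e}"] fin_shared[OF T(1)] by auto
    \<comment> \<open>An outside triangle touching the chain does so at \<open>x\<close>, which
      already lies in \<open>T\<close> and \<open>T'\<close>; a third triangle there is
      excluded.\<close>
    have only_T': "T'' = T'" if "T'' \<in> \<T> - \<S>" "y \<in> T''" "y \<in> \<Union>\<S>" for T'' y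
    proof -
      have "y \<in> T - {e}" using outside[OF that(1)] that by auto
      moreover have "T'' \<noteq> T" using that(1) IH(3) by auto
      ultimately have "y \<in> shared T - {e}" using that by (auto simp: shared_def)
      then have "y = x" using only_x by auto
      then show ?thesis
        using at_most_two[of T T' T'' x] T T' x that IH(3) by auto
    qed
    have meet: "\<Union>\<S> \<inter> T' = {x}"
    proof -
      have "y = x" if "y \<in> \<Union>\<S>" "y \<in> T'" for y
      proof -
        have "y \<in> T - {e}" using outside[of T'] T' that by auto
        then have "y \<in> shared T - {e}" using T' T that by (auto simp: shared_def)
        then show ?thesis using only_x by auto
      qed
      then show ?thesis using T'(3,4) by blast
    qed
    have "x \<in> shared T'" using x(1) T T'(3) by (auto simp: shared_def)
    then have "card (shared T' - {x}) \<le> 1"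
      using shared[OF T'(1)] fin_shared[OF T'(1)] by simp
    moreover have "triangle_chain (Suc (Suc i)) u z (triangle_union (insert T' \<S>))" if "z \<in> T' - {x}" for z
      using triangle_chain.triangle[OF chain[of x], of T' z] three[OF T'(1)] meet x that
      by (simp add: triangle_union_insert)
    moreover have "T'' \<inter> \<Union>(insert T' \<S>) \<subseteq> T' - {x}" if "T'' \<in> \<T> - insert T' \<S>" for T''
    proof
      fix y assume y: "y \<in> T'' \<inter> \<Union>(insert T' \<S>)"
      have "y \<notin> \<Union>\<S>" using only_T'[of T'' y] that y by auto
      then show "y \<in> T' - {x}" using y T'(4) by auto
    qed
    moreover have "card (insert T' \<S>) = Suc (Suc i)"
      using IH(1,2) T'(2) fin by (simp add: finite_subset)
    ultimately show ?case
      using T'(1,3) IH(1) by (intro exI[of _ "insert T' \<S>"] exI[of _ T'] exI[of _ x]) auto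
  qed
  have pos: "card \<T> > 0" using fin T1(1) by (auto simp: card_gt_0_iff)
  then obtain \<S> T e where S: "\<S> \<subseteq> \<T>" "card \<S> = card \<T>" "T \<in> \<S>" "e \<in> T"
    and chain: "\<And>z. z \<in> T - {e} \<Longrightarrow> triangle_chain (card \<T>) u z (triangle_union \<S>)"
    using grow[of "card \<T> - 1"] by (metis Suc_diff_1 diff_less zero_less_one)
  have "\<S> = \<T>" using S fin by (simp add: card_subset_eq)
  \<comment> \<open>The last triangle still has vertices besides its entry; any of them can be the
    far terminal.\<close>
  moreover have "card (T - {e}) = 2" using three[of T] S by auto
  then obtain z where "z \<in> T - {e}" by (metis card.empty ex_in_conv zero_neq_numeral)
  ultimately show ?thesis using chain by auto
qed

section \<open>Blocks\<close>

text \<open>Connectedness of the subgraph induced on \<open>S\<close>, phrased with walks inside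
  \<open>S\<close>, so that deleting a vertex is a set difference.\<close>

definition linked :: "'a rel \<Rightarrow> 'a set \<Rightarrow> bool" where
  "linked E S \<longleftrightarrow> (\<forall>y\<in>S. \<forall>z\<in>S. (y, z) \<in> rtrancl_on S E)"

lemma rtrancl_on_sym_iff: "sym E \<Longrightarrow> (x, y) \<in> rtrancl_on S E \<longleftrightarrow> (y, x) \<in> rtrancl_on S E"
  using symD[OF rtrancl_on_sym[of E S]] by blast

lemma linked_hub:
  assumes "sym E" "\<And>p. p \<in> S \<Longrightarrow> (p, h) \<in> rtrancl_on S E"
  shows "linked E S"
  unfolding linked_def
proof (intro ballI)
  fix y z assume "y \<in> S" "z \<in> S"
  then have "(y, h) \<in> rtrancl_on S E" "(h, z) \<in> rtrancl_on S E"
    using assms(2) rtrancl_on_sym_iff[OF assms(1)] by blast+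
  then show "(y, z) \<in> rtrancl_on S E" by (rule rtrancl_on_trans)
qed

lemma rtrancl_on_subset: "(x, y) \<in> rtrancl_on S E \<Longrightarrow> S \<subseteq> S' \<Longrightarrow> (x, y) \<in> rtrancl_on S' E"
  by (rule rtrancl_on_mono[OF order_refl])

lemma rtrancl_on_restrict: "(x, y) \<in> rtrancl_on S E \<Longrightarrow> (x, y) \<in> rtrancl_on S (E \<inter> S \<times> S)"
proof (induction rule: rtrancl_on_induct)
  case (step y z)
  then show ?case by (intro rtrancl_on_into_rtrancl_on[OF step(5)]) auto
qed auto

text \<open>\<open>path_set E y S z\<close>: \<open>S\<close> is the vertex set of a simple path from \<open>y\<close> to \<open>z\<close>.\<close>

inductive path_set :: "'a rel \<Rightarrow> 'a \<Rightarrow> 'a set \<Rightarrow> 'a \<Rightarrow> bool" for E where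
  refl: "path_set E y {y} y"
| step: "path_set E x (insert x S) z" if "path_set E y S z" "(x, y) \<in> E" "x \<notin> S"

lemma path_set_ends: "path_set E y S z \<Longrightarrow> y \<in> S \<and> z \<in> S"
  by (induction rule: path_set.induct) auto

text \<open>The final piece of the path from \<open>x\<close> on. It removes the repetition when a
  walk returns to a vertex already on the path.\<close>

lemma path_set_shorten:
  "path_set E y S z \<Longrightarrow> x \<in> S \<Longrightarrow> \<exists>S'\<subseteq>S. path_set E x S' z"
proof (induction rule: path_set.induct)
  case (step y S z w)
  then show ?case
    by (metis insert_iff order_refl path_set.step subset_insertI2)
qed (auto intro: path_set.refl)

lemma path_set_exists:
  assumes "(y, z) \<in> rtrancl_on W E"
  shows "\<exists>S\<subseteq>W. path_set E y S z"
  using assms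
proof (induction rule: converse_rtrancl_on_induct)
  case base
  then show ?case by (auto intro: path_set.refl)
next
  case (step x y)
  then obtain S where S: "S \<subseteq> W" "path_set E y S z" by blast
  show ?case
  proof (cases "x \<in> S")
    case True
    then show ?thesis using path_set_shorten[OF S(2)] S(1) by (meson subset_trans)
  next
    case False
    then show ?thesis using path_set.step[OF S(2) step(1)] S(1) step(3) by blast
  qed
qed

lemma path_set_linked:
  assumes "path_set E y S z" "p \<in> S"
  shows "(p, z) \<in> rtrancl_on S E"
  using assms
proof (induction arbitrary: p rule: path_set.induct)
  case (step y S z x)
  have *: "(q, z) \<in> rtrancl_on (insert x S) E" if "q \<in> S" for q
    using step.IH[OF that] by (rule rtrancl_on_subset) auto
  show ?case
    using * converse_rtrancl_on_into_rtrancl_on[OF step.hyps(2) *[of y]] path_set_ends[OF step.hyps(1)]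
      step.prems by auto
qed auto

text \<open>Deleting a vertex of a simple path leaves two pieces, each of which keeps an end of the path.\<close>

lemma path_set_delete:
  assumes "path_set E y S z" "sym E" "p \<in> S - Q" "Q \<subseteq> {q}"
  shows "(p, y) \<in> rtrancl_on (S - Q) E \<or> (p, z) \<in> rtrancl_on (S - Q) E"
  using assms(1,3)
proof (induction arbitrary: p rule: path_set.induct)
  case (step y S z x)
  show ?case
  proof (cases "x \<in> Q")
    case True
    then have "insert x S - Q = S" using assms(4) step.hyps(3) by auto
    then show ?thesis using path_set_linked[OF step.hyps(1)] step.prems by auto
  next
    case False
    show ?thesis
    proof (cases "p = x")
      case True
      then show ?thesis using step.prems by auto
    next
      case False
      then have "p \<in> S - Q" using step.prems by auto
      then have "(p, y) \<in> rtrancl_on (insert x S - Q) E \<or> (p, z) \<in> rtrancl_on (insert x S - Q) E"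
        using step.IH by (blast intro: rtrancl_on_subset)
      moreover have "(y, x) \<in> E" using step.hyps(2) assms(2) by (auto dest: symD)
      ultimately show ?thesis
        using \<open>x \<notin> Q\<close> by (auto intro: rtrancl_on_into_rtrancl_on)
    qed
  qed
qed auto

text \<open>After deleting \<open>x\<close> the two sets are still joined by the path; after deleting any other vertex
  they are still joined at \<open>x\<close>.\<close>

lemma linked_theta:
  assumes "sym E" and B: "\<And>Q q. Q \<subseteq> {q} \<Longrightarrow> linked E (B - Q)" and B': "\<And>Q q. Q \<subseteq> {q} \<Longrightarrow> linked E (B' - Q)"
    and x: "x \<in> B" "x \<in> B'" and path: "path_set E y S z" "y \<in> B" "z \<in> B'" "x \<notin> S" and Q: "Q \<subseteq> {q}"
  shows "linked E (B \<union> B' \<union> S - Q)" (is "linked E ?W")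
proof (cases "x \<in> Q")
  case True
  then have Qx: "Q = {x}" using Q by auto
  have ends: "y \<in> S" "z \<in> S" using path_set_ends[OF path(1)] by auto
  have S: "(p, z) \<in> rtrancl_on ?W E" if "p \<in> S" for p
    using path_set_linked[OF path(1) that] by (rule rtrancl_on_subset) (use Qx path(4) in auto)
  show ?thesis
  proof (rule linked_hub[OF assms(1)])
    fix p assume "p \<in> ?W"
    then consider "p \<in> B - Q" | "p \<in> B' - Q" | "p \<in> S" by auto
    then show "(p, z) \<in> rtrancl_on ?W E"
    proof cases
      case 1
      have "(p, y) \<in> rtrancl_on (B - Q) E"
        using B[OF Q] 1 path ends Qx by (auto simp: linked_def)
      then have "(p, y) \<in> rtrancl_on ?W E" by (rule rtrancl_on_subset) auto
      then show ?thesis using S[OF ends(1)] by (rule rtrancl_on_trans)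
    next
      case 2
      have "(p, z) \<in> rtrancl_on (B' - Q) E"
        using B'[OF Q] 2 path ends Qx by (auto simp: linked_def)
      then show ?thesis by (rule rtrancl_on_subset) auto
    qed (rule S)
  qed
next
  case False
  have BW: "(p, x) \<in> rtrancl_on ?W E" if "p \<in> B - Q \<or> p \<in> B' - Q" for p
  proof -
    have "(p, x) \<in> rtrancl_on (B - Q) E \<or> (p, x) \<in> rtrancl_on (B' - Q) E"
      using B[OF Q] B'[OF Q] that x False by (auto simp: linked_def)
    then show ?thesis by (auto elim!: rtrancl_on_subset)
  qed
  show ?thesis
  proof (rule linked_hub[OF assms(1)])
    fix p assume p: "p \<in> ?W"
    show "(p, x) \<in> rtrancl_on ?W E"
    proof (cases "p \<in> S")
      case True
      then obtain w where w: "w = y \<or> w = z" "(p, w) \<in> rtrancl_on (S - Q) E"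
        using path_set_delete[OF path(1) assms(1) _ Q, of p] p by auto
      then have "w \<in> B - Q \<or> w \<in> B' - Q" using in_rtrancl_on_in_F(2)[OF w(2)] path by auto
      moreover have "(p, w) \<in> rtrancl_on ?W E" using w(2) by (rule rtrancl_on_subset) auto
      ultimately show ?thesis using BW rtrancl_on_trans by metis
    qed (use BW p in auto)
  qed
qed

text \<open>Letting \<open>Q\<close> be empty or a singleton treats connectedness and the absence of
  cut vertices as one condition.\<close>

lemma nonseparable_imp_linked:
  assumes "nonseparable B" "arcs_ends B \<subseteq> E" "Q \<subseteq> {q}"
  shows "linked E (verts B - Q)"
proof -
  interpret graph B using assms(1) by (simp add: nonseparable_def)
  have "strongly_connected B"
    using symmetric_connected_imp_strongly_connected[OF sym_arcs] assms(1)
    by (simp add: nonseparable_def)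
  then have conn: "y \<rightarrow>\<^sup>*\<^bsub>B\<^esub> z" if "y \<in> verts B" "z \<in> verts B" for y z
    using that by auto
  show ?thesis
  proof (cases "Q \<inter> verts B = {}")
    case True
    then have "verts B - Q = verts B" by auto
    then show ?thesis
      using conn assms(2) by (auto simp: linked_def reachable_def intro: rtrancl_on_mono[OF assms(2)])
  next
    case False
    then have Q: "Q = {q}" "q \<in> verts B" using assms(3) by auto
    have sub: "arcs_ends (del_vert q) \<subseteq> E"
      using assms(2) by (auto simp: arcs_ends_conv del_vert_simps)
    have "(y, z) \<in> rtrancl_on (verts B - Q) E" if "y \<in> verts B - Q" "z \<in> verts B - Q" for y z
    proof -
      have "y \<rightarrow>\<^sup>*\<^bsub>del_vert q\<^esub> z"
        using assms(1) Q conn that unfolding nonseparable_def cut_vertex_def by blast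
      then show ?thesis
        using rtrancl_on_mono[OF sub order_refl, of y z "verts B - Q"]
        by (simp add: reachable_def del_vert_simps Q(1))
    qed
    then show ?thesis by (simp add: linked_def)
  qed
qed

section \<open>Blocks of a finite simple graph\<close>

context pair_graph
begin

text \<open>The largest subgraph on \<open>W\<close>: it contains every subgraph with vertices in
  \<open>W\<close>, which is how maximality of blocks is exploited.\<close>

definition induced :: "'a set \<Rightarrow> ('a, 'a \<times> 'a) pre_digraph" where
  "induced W = with_proj \<lparr> pverts = W, parcs = parcs G \<inter> W \<times> W \<rparr>"

lemma induced_simps [simp]:
  "verts (induced W) = W" "arcs (induced W) = parcs G \<inter> W \<times> W"
  "tail (induced W) = fst" "head (induced W) = snd" "arcs_ends (induced W) = parcs G \<inter> W \<times> W"
  by (simp_all add: induced_def)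

lemma sym_parcs: "sym (parcs G)"
  using pair_sym_arcs by (simp add: symmetric_def)

lemma graph_induced:
  assumes "W \<subseteq> pverts G"
  shows "graph (induced W)"
proof -
  have "finite W" using assms pair_finite_verts finite_subset by blast
  then show ?thesis
    using sym_parcs pair_finite_arcs no_loops'
    by unfold_locales (auto simp: symmetric_def sym_def arc_to_ends_def)
qed

lemma nonseparable_induced:
  assumes "W \<subseteq> pverts G" "W \<noteq> {}" and linked: "\<And>Q q. Q \<subseteq> {q} \<Longrightarrow> linked (parcs G) (W - Q)"
  shows "nonseparable (induced W)"
proof -
  have gr: "graph (induced W)" by (rule graph_induced[OF assms(1)])
  interpret H: graph "induced W" by (rule gr)
  have "(y, z) \<in> rtrancl_on W (parcs G)" if "y \<in> W" "z \<in> W" for y z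
    using linked[of "{}"] that by (simp add: linked_def)
  then have "strongly_connected (induced W)"
    using assms(2) rtrancl_on_restrict[of _ _ W "parcs G"]
    by (simp add: strongly_connected_def reachable_def)
  then have "connected (induced W)"
    by (intro H.connectedI) (auto simp: strongly_connected_def intro: H.reachable_mk_symmetricI)
  moreover have "\<not> cut_vertex (induced W) q" for q
  proof -
    have "arcs_ends (H.del_vert q) = parcs G \<inter> (W - {q}) \<times> (W - {q})"
      by (auto simp: arcs_ends_conv H.del_vert_simps)
    moreover have "(y, z) \<in> rtrancl_on (W - {q}) (parcs G \<inter> (W - {q}) \<times> (W - {q}))"
      if "y \<in> W - {q}" "z \<in> W - {q}" for y z
      using linked[of "{q}" q] that by (intro rtrancl_on_restrict) (auto simp: linked_def)
    ultimately have "y \<rightarrow>\<^sup>*\<^bsub>H.del_vert q\<^esub> z" if "y \<in> W - {q}" "z \<in> W - {q}" for y z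
      using that by (simp add: reachable_def H.del_vert_simps)
    \<comment> \<open>The witnesses in \<open>cut_vertex\<close> are arbitrary elements;
      reachability of one from the other places them in \<open>W\<close>.\<close>
    then show ?thesis
      using H.reachable_in_verts unfolding cut_vertex_def
      by (metis Diff_iff induced_simps(1) singletonD)
  qed
  ultimately show ?thesis using gr by (simp add: nonseparable_def)
qed

lemma subgraph_induced:
  assumes W: "W \<subseteq> pverts G"
  shows "subgraph (induced W) (with_proj G)"
proof -
  interpret H: graph "induced W" by (rule graph_induced[OF W])
  show ?thesis
    using W wf_digraph H.wf_digraph by (auto simp: subgraph_def compatible_def)
qed

lemma subgraph_of_induced:
  assumes "subgraph B (with_proj G)" "verts B \<subseteq> W" "W \<subseteq> pverts G"
  shows "subgraph B (induced W)"
proof -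
  interpret B: wf_digraph B using assms(1) by auto
  have ends: "tail B = fst" "head B = snd" using assms(1) by (auto simp: subgraph_def compatible_def)
  interpret H: graph "induced W" by (rule graph_induced[OF assms(3)])
  have "arcs B \<subseteq> W \<times> W"
    using B.tail_in_verts B.head_in_verts assms(2) by (force simp: ends)
  then show ?thesis
    using assms H.wf_digraph by (auto simp: subgraph_def compatible_def)
qed

text \<open>A single edge is nonseparable, and by finiteness some nonseparable subgraph containing
  the arc has greatest size; it is a block.\<close>

lemma arc_in_block:
  assumes "(x, y) \<in> parcs G"
  shows "\<exists>B\<in>blocks (with_proj G). (x, y) \<in> arcs B"
proof -
  let ?P = "\<lambda>B. subgraph B (with_proj G) \<and> nonseparable B \<and> (x, y) \<in> arcs B"
  \<comment> \<open>Arcs are counted too, because a subgraph can grow without gaining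
    vertices.\<close>
  let ?m = "\<lambda>B::('a, 'a \<times> 'a) pre_digraph. card (verts B) + card (arcs B)"
  have xy: "{x, y} \<subseteq> pverts G" using assms in_arcsD1 in_arcsD2 by auto
  have "linked (parcs G) ({x, y} - Q)" if "Q \<subseteq> {q}" for Q q
  proof -
    have "(y, x) \<in> parcs G" using assms sym_parcs by (auto dest: symD)
    then have "(v, w) \<in> rtrancl_on ({x, y} - Q) (parcs G)" if "v \<in> {x, y} - Q" "w \<in> {x, y} - Q" for v w
      using that assms
      by (cases "v = w") (auto intro: rtrancl_on_into_rtrancl_on[OF rtrancl_on_refl])
    then show ?thesis by (auto simp: linked_def)
  qed
  then have "?P (induced {x, y})"
    using nonseparable_induced[OF xy] subgraph_induced[OF xy] assms by auto
  moreover have "?m B < Suc (card (pverts G) + card (parcs G))" if "?P B" for B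
    using that pair_finite_verts pair_finite_arcs
    by (intro le_imp_less_Suc add_mono card_mono) (auto simp: subgraph_def)
  ultimately have "\<exists>B. ?P B \<and> (\<forall>B'. ?P B' \<longrightarrow> ?m B' \<le> ?m B)"
    by (intro ex_has_greatest_nat[of ?P "induced {x, y}" ?m "Suc (card (pverts G) + card (parcs G))"])
      auto
  then obtain B where B: "subgraph B (with_proj G)" "nonseparable B" "(x, y) \<in> arcs B"
    and greatest: "\<forall>B'. ?P B' \<longrightarrow> ?m B' \<le> ?m B"
    by (elim exE conjE) (rule that)
  have "B' = B" if "subgraph B B'" "subgraph B' (with_proj G)" "nonseparable B'" for B'
  proof -
    have sub: "verts B \<subseteq> verts B'" "arcs B \<subseteq> arcs B'" "verts B' \<subseteq> pverts G" "arcs B' \<subseteq> parcs G"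
      using that by (auto simp: subgraph_def)
    then have fin: "finite (verts B')" "finite (arcs B')"
      using pair_finite_verts pair_finite_arcs finite_subset by blast+
    have "?m B' \<le> ?m B" using B(3) that sub(2) greatest by blast
    moreover have "card (verts B) \<le> card (verts B')" "card (arcs B) \<le> card (arcs B')"
      using sub fin by (simp_all add: card_mono)
    ultimately have "verts B = verts B'" "arcs B = arcs B'"
      using sub fin by (simp_all add: card_subset_eq)
    then show ?thesis using that(1) by (simp add: subgraph_def compatible_def)
  qed
  then have "B \<in> blocks (with_proj G)"
    using B by (auto simp: blocks_def pre_digraph.max_subgraph_def)
  then show ?thesis using B(3) by blast
qed

lemma shared_vertex_is_cut_vertex:
  assumes conn: "connected (with_proj G)"
    and B: "B \<in> blocks (with_proj G)" "B' \<in> blocks (with_proj G)" "B \<noteq> B'"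
    and x: "x \<in> verts B" "x \<in> verts B'" and y: "y \<in> verts B" "y \<noteq> x" and z: "z \<in> verts B'" "z \<noteq> x"
  shows "cut_vertex (with_proj G) x"
proof (rule ccontr)
  assume not_cut: "\<not> cut_vertex (with_proj G) x"
  have B_block: "subgraph B (with_proj G)" "nonseparable B" "subgraph B' (with_proj G)" "nonseparable B'"
    and maximal: "\<And>H. \<lbrakk>subgraph B H; subgraph H (with_proj G); nonseparable H\<rbrakk> \<Longrightarrow> H = B"
      "\<And>H. \<lbrakk>subgraph B' H; subgraph H (with_proj G); nonseparable H\<rbrakk> \<Longrightarrow> H = B'"
    using B by (auto simp: blocks_def pre_digraph.max_subgraph_def)
  have sub: "verts B \<subseteq> pverts G" "verts B' \<subseteq> pverts G"
    using B_block by (auto simp: subgraph_def)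
  have ends: "arcs_ends B \<subseteq> parcs G" "arcs_ends B' \<subseteq> parcs G"
    using B_block arcs_ends_mono[of B "with_proj G"] arcs_ends_mono[of B' "with_proj G"] by auto
  have "strongly_connected (with_proj G)"
    using symmetric_connected_imp_strongly_connected[OF pair_sym_arcs conn] .
  then have "y \<rightarrow>\<^sup>*\<^bsub>with_proj G\<^esub> z" using y z sub by (auto simp: strongly_connected_def)
  \<comment> \<open>If \<open>x\<close> is no cut vertex, some walk between the blocks avoids
    it.\<close>
  then have "y \<rightarrow>\<^sup>*\<^bsub>del_vert x\<^esub> z"
    using not_cut x sub y z unfolding cut_vertex_def by auto
  moreover have "arcs_ends (del_vert x) \<subseteq> parcs G"
    by (auto simp: arcs_ends_conv pre_digraph.del_vert_simps)
  ultimately have "(y, z) \<in> rtrancl_on (pverts G - {x}) (parcs G)"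
    by (auto simp: reachable_def pre_digraph.del_vert_simps intro: rtrancl_on_mono)
  from path_set_exists[OF this] obtain S where S: "S \<subseteq> pverts G - {x}" "path_set (parcs G) y S z"
    by (elim exE conjE)
  define W where "W = verts B \<union> verts B' \<union> S"
  have W: "W \<subseteq> pverts G" using S sub by (auto simp: W_def)
  have "nonseparable (induced W)"
  proof (rule nonseparable_induced[OF W])
    fix Q and q :: 'a assume Q: "Q \<subseteq> {q}"
    show "linked (parcs G) (W - Q)"
      unfolding W_def
      by (rule linked_theta[OF sym_parcs nonseparable_imp_linked[OF B_block(2) ends(1)]
            nonseparable_imp_linked[OF B_block(4) ends(2)] x S(2) y(1) z(1) _ Q]) (use S in auto)
  qed (use x in \<open>auto simp: W_def\<close>)
  \<comment> \<open>Both blocks lie in the nonseparable graph on \<open>W\<close>, so each equals it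
    by maximality.\<close>
  then have "induced W = B" "induced W = B'"
    using maximal subgraph_of_induced[OF B_block(1) _ W] subgraph_of_induced[OF B_block(3) _ W]
      subgraph_induced[OF W] by (auto simp: W_def)
  then show False using B(3) by simp
qed

text \<open>Each vertex has two out-arcs and only two other vertices to receive them. Arcs are pairs
  here, so counting arcs counts neighbours.\<close>

lemma triangle_subgraph_arcs:
  assumes "subgraph B (with_proj G)" "is_triangle B"
  shows "arcs B = parcs (clique (verts B))"
proof -
  interpret B: graph B using assms(2) by (simp add: is_triangle_def is_cycle_graph_def)
  have ends: "tail B = fst" "head B = snd" using assms(1) by (auto simp: subgraph_def compatible_def)
  have arcs: "x \<in> verts B" "y \<in> verts B" "x \<noteq> y" if "(x, y) \<in> arcs B" for x y
    using B.tail_in_verts[OF that] B.head_in_verts[OF that] B.no_loops[OF that] by (simp_all add: ends)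
  have complete: "(x, y) \<in> arcs B" if "x \<in> verts B" "y \<in> verts B" "x \<noteq> y" for x y
  proof -
    have "out_arcs B x \<subseteq> Pair x ` (verts B - {x})"
    proof
      fix e assume "e \<in> out_arcs B x"
      then have "(x, snd e) \<in> arcs B" "e = (x, snd e)" by (auto simp: ends)
      then show "e \<in> Pair x ` (verts B - {x})" using arcs[of x "snd e"] by blast
    qed
    moreover have "card (out_arcs B x) = 2"
      using assms(2) that(1) by (simp add: is_triangle_def is_cycle_graph_def out_degree_def)
    moreover have "card (Pair x ` (verts B - {x})) = 2"
      using assms(2) that(1) by (simp add: card_image inj_on_def is_triangle_def)
    ultimately have "out_arcs B x = Pair x ` (verts B - {x})"
      by (intro card_subset_eq) simp_all
    then have "(x, y) \<in> out_arcs B x" using that by auto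
    then show ?thesis by simp
  qed
  have "(x, y) \<in> arcs B \<longleftrightarrow> (x, y) \<in> parcs (clique (verts B))" for x y
    using arcs[of x y] complete[of x y] by auto
  then show ?thesis by auto
qed

end

section \<open>Recognising Q_j as a triangle chain\<close>

lemma is_Q_triangle_chain:
  assumes Q: "is_Q j G" and u: "attachment_vertex G u"
  shows "\<exists>b. triangle_chain j u b G"
proof (cases "j = 0")
  case True
  interpret pair_graph G using Q by (simp add: is_Q_def)
  have "card (pverts G) = 1" using True Q by (simp add: is_Q_def)
  then have V: "pverts G = {u}" using u by (auto simp: attachment_vertex_def card_1_singleton_iff)
  have "parcs G = {}"
  proof (rule ccontr)
    assume "parcs G \<noteq> {}"
    then obtain x y where xy: "(x, y) \<in> parcs G" by auto
    then have "x = u" "y = u" using V in_arcsD1 in_arcsD2 by auto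
    then show False using no_loops' xy by auto
  qed
  then have "G = clique {u}" using V by (intro pair_pre_digraph.equality) auto
  then show ?thesis using True triangle_chain.vertex[of u] by blast
next
  case False
  interpret pair_graph G using Q by (simp add: is_Q_def)
  let ?blocks = "blocks (with_proj G)"
  have chain: "chain_cactus (with_proj G)" and card_blocks: "card ?blocks = j"
    and triangles: "\<And>B. B \<in> ?blocks \<Longrightarrow> is_triangle B"
    using Q False by (auto simp: is_Q_def)
  have conn: "connected (with_proj G)" using chain by (simp add: chain_cactus_def cactus_def)
  have fin_blocks: "finite ?blocks" using card_blocks False card_ge_0_finite by force
  have sub: "subgraph B (with_proj G)" if "B \<in> ?blocks" for B
    using that by (simp add: blocks_def pre_digraph.max_subgraph_def)
  have arcs: "arcs B = parcs (clique (verts B))" if "B \<in> ?blocks" for B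
    using triangle_subgraph_arcs[OF sub[OF that] triangles[OF that]] .
  have three: "card (verts B) = 3" if "B \<in> ?blocks" for B
    using triangles[OF that] by (simp add: is_triangle_def)
  have fin_verts: "finite (verts B)" if "B \<in> ?blocks" for B
    using three[OF that] card_ge_0_finite by force
  \<comment> \<open>A triangle is determined by its vertex set, so replacing blocks by vertex sets
    keeps their number.\<close>
  have verts_eq: "B = B'" if "B \<in> ?blocks" "B' \<in> ?blocks" "verts B = verts B'" for B B'
    using sub[OF that(1)] sub[OF that(2)] arcs[OF that(1)] arcs[OF that(2)] that(3)
    by (intro pre_digraph.equality) (auto simp: subgraph_def compatible_def)
  have other: "\<exists>y\<in>verts B. y \<noteq> x" if "B \<in> ?blocks" for B x
  proof (rule ccontr)
    assume "\<not> (\<exists>y\<in>verts B. y \<noteq> x)"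
    then have "card (verts B) \<le> card {x}" by (intro card_mono) auto
    then show False using three[OF that] by simp
  qed
  have cut: "cut_vertex (with_proj G) x"
    if "B \<in> ?blocks" "B' \<in> ?blocks" "B \<noteq> B'" "x \<in> verts B" "x \<in> verts B'" for B B' x
    using shared_vertex_is_cut_vertex[OF conn that] other[OF that(1)] other[OF that(2)] by metis
  define \<T> where "\<T> = verts ` ?blocks"
  \<comment> \<open>A walk cannot leave such a family: each of its arcs lies in a block, and a block
    meeting the family belongs to it. This yields both the covering of \<open>G\<close> and the
    connectedness hypothesis.\<close>
  have closed: "pverts G \<subseteq> \<Union>\<S>"
    if \<S>: "\<S> \<subseteq> \<T>" "\<S> \<noteq> {}" "\<And>T. T \<in> \<T> - \<S> \<Longrightarrow> T \<inter> \<Union>\<S> = {}" for \<S>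
  proof
    fix z assume z: "z \<in> pverts G"
    obtain B where B: "B \<in> ?blocks" "verts B \<in> \<S>" using \<S>(1,2) by (auto simp: \<T>_def)
    obtain y where y: "y \<in> verts B" using three[OF B(1)] by fastforce
    have "y \<in> pverts G" using sub[OF B(1)] y by (auto simp: subgraph_def)
    then have "(y, z) \<in> rtrancl_on (pverts G) (parcs G)"
      using symmetric_connected_imp_strongly_connected[OF pair_sym_arcs conn] z
      by (auto simp: strongly_connected_def reachable_def)
    then show "z \<in> \<Union>\<S>"
    proof (induction rule: rtrancl_on_induct)
      case base
      then show ?case using y B by auto
    next
      case (step v w)
      obtain B' where B': "B' \<in> ?blocks" "(v, w) \<in> arcs B'" using arc_in_block[OF step(2)] by blast
      then have vw: "v \<in> verts B'" "w \<in> verts B'" using arcs[OF B'(1)] by auto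
      then have "verts B' \<in> \<S>" using \<S>(3)[of "verts B'"] B'(1) step(5) by (auto simp: \<T>_def)
      then show ?case using vw by auto
    qed
  qed
  have "\<T> \<noteq> {}" using card_blocks False by (auto simp: \<T>_def)
  have V: "pverts G = \<Union>\<T>"
  proof
    show "pverts G \<subseteq> \<Union>\<T>" using closed[of \<T>] \<open>\<T> \<noteq> {}\<close> by auto
    show "\<Union>\<T> \<subseteq> pverts G" using sub by (fastforce simp: \<T>_def subgraph_def)
  qed
  have E: "parcs G = (\<Union>T\<in>\<T>. parcs (clique T))"
  proof
    show "parcs G \<subseteq> (\<Union>T\<in>\<T>. parcs (clique T))"
    proof
      fix e assume "e \<in> parcs G"
      then obtain B where "B \<in> ?blocks" "e \<in> arcs B" using arc_in_block by (cases e) blast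
      then show "e \<in> (\<Union>T\<in>\<T>. parcs (clique T))" using arcs by (auto simp: \<T>_def)
    qed
    have "parcs (clique (verts B)) \<subseteq> parcs G" if "B \<in> ?blocks" for B
      using sub[OF that] arcs[OF that] by (auto simp: subgraph_def)
    then show "(\<Union>T\<in>\<T>. parcs (clique T)) \<subseteq> parcs G" unfolding \<T>_def by blast
  qed
  have G: "G = triangle_union \<T>" using V E by (simp add: triangle_union_def)
  have card: "card \<T> = j"
    unfolding \<T>_def card_blocks[symmetric] by (rule card_image) (auto intro: inj_onI verts_eq)
  define shared where "shared = (\<lambda>T. {x \<in> T. \<exists>T'\<in>\<T>. T' \<noteq> T \<and> x \<in> T'})"
  \<comment> \<open>Shared vertices are cut vertices, so the bounds on cut vertices of a block carry
    over.\<close>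
  have shared: "card (shared (verts B)) \<le> card (block_cut_vertices (with_proj G) B)" if "B \<in> ?blocks" for B
  proof (rule card_mono)
    show "finite (block_cut_vertices (with_proj G) B)"
      using fin_verts[OF that] by (simp add: block_cut_vertices_def)
    show "shared (verts B) \<subseteq> block_cut_vertices (with_proj G) B"
      using cut[OF that] by (auto simp: shared_def block_cut_vertices_def \<T>_def)
  qed
  have "\<exists>T1\<in>\<T>. card (shared T1) \<le> 1 \<and> u \<in> T1 \<and> u \<notin> shared T1"
  proof (cases "j = 1")
    case True
    then obtain T where T: "\<T> = {T}" using card by (auto simp: card_1_singleton_iff)
    have "u \<in> T" using u V T by (simp add: attachment_vertex_def)
    then show ?thesis using T by (simp add: shared_def)
  next
    case j: False
    then obtain B where B: "terminal_block (with_proj G) B" "u \<in> verts B"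
      and deg: "out_degree (with_proj G) u = 2"
      using u card_blocks False by (auto simp: attachment_vertex_def)
    have B': "B \<in> ?blocks" using B by (simp add: terminal_block_def)
    have le1: "card (shared (verts B)) \<le> 1"
      using shared[OF B'] B by (simp add: terminal_block_def)
    \<comment> \<open>A triangle through \<open>u\<close> already uses both arcs leaving
      \<open>u\<close>, so all blocks through \<open>u\<close> have the same vertices.\<close>
    have unique: "verts B' = verts B" if "B' \<in> ?blocks" "u \<in> verts B'" for B'
    proof -
      have "out_arcs (with_proj G) u = Pair u ` (verts C - {u})" if "C \<in> ?blocks" "u \<in> verts C" for C
      proof (rule card_subset_eq[symmetric])
        show "finite (out_arcs (with_proj G) u)" using pair_finite_arcs by (simp add: out_arcs_def)
        show "Pair u ` (verts C - {u}) \<subseteq> out_arcs (with_proj G) u"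
          using that by (auto simp: E \<T>_def)
        show "card (Pair u ` (verts C - {u})) = card (out_arcs (with_proj G) u)"
          using three[OF that(1)] that(2) deg by (simp add: card_image inj_on_def out_degree_def)
      qed
      then have "Pair u ` (verts B' - {u}) = Pair u ` (verts B - {u})"
        using that B B' by metis
      then have "verts B' - {u} = verts B - {u}" by (simp add: inj_image_eq_iff inj_on_def)
      then show ?thesis using that(2) B(2) by blast
    qed
    have "u \<notin> shared (verts B)" unfolding shared_def \<T>_def using unique by blast
    then show ?thesis
      using le1 B(2) B' by (intro bexI[of _ "verts B"] conjI) (simp_all add: \<T>_def)
  qed
  then obtain T1 where T1: "T1 \<in> \<T>" "card (shared T1) \<le> 1" "u \<in> T1" "u \<notin> shared T1" by blast
  have "\<exists>b. triangle_chain (card \<T>) u b (triangle_union \<T>)"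
  proof (rule triangle_chain_of_triangles[where ?T1.0 = T1])
    show "finite \<T>" using fin_blocks by (simp add: \<T>_def)
    show "card T = 3" if "T \<in> \<T>" for T using that three by (auto simp: \<T>_def)
    show "T'' = T \<or> T'' = T'"
      if T: "T \<in> \<T>" "T' \<in> \<T>" "T'' \<in> \<T>" "x \<in> T" "x \<in> T'" "x \<in> T''" "T \<noteq> T'" for x T T' T''
    proof -
      obtain B B' B'' where B: "B \<in> ?blocks" "B' \<in> ?blocks" "B'' \<in> ?blocks"
        "T = verts B" "T' = verts B'" "T'' = verts B''"
        using T by (auto simp: \<T>_def)
      have "cut_vertex (with_proj G) x" using cut[of B B' x] B that by auto
      then have "card {B \<in> ?blocks. x \<in> verts B} = 2" using chain by (simp add: chain_cactus_def)
      moreover have "{B, B'} \<subseteq> {B \<in> ?blocks. x \<in> verts B}" using B that by auto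
      moreover have "B \<noteq> B'" using B T(7) by blast
      then have "card {B, B'} = 2" by simp
      ultimately have "{B, B'} = {B \<in> ?blocks. x \<in> verts B}"
        using fin_blocks by (intro card_subset_eq) auto
      then have "B'' \<in> {B, B'}" using B that by auto
      then show ?thesis using B by auto
    qed
    show "card {x \<in> T. \<exists>T'\<in>\<T>. T' \<noteq> T \<and> x \<in> T'} \<le> 2" if T: "T \<in> \<T>" for T
    proof -
      obtain B where B: "B \<in> ?blocks" "T = verts B" using T by (auto simp: \<T>_def)
      then have "card (block_cut_vertices (with_proj G) B) \<le> 2" using chain by (simp add: chain_cactus_def)
      then show ?thesis using shared[OF B(1)] B(2) by (simp add: shared_def)
    qed
    show "\<exists>T\<in>\<T> - \<S>. T \<inter> \<Union>\<S> \<noteq> {}" if \<S>: "\<S> \<subseteq> \<T>" "\<S> \<noteq> {}" "\<S> \<noteq> \<T>" for \<S>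
    proof (rule ccontr)
      assume none: "\<not> ?thesis"
      \<comment> \<open>A separated subfamily would cover all of \<open>G\<close>, including the
        vertices of a block outside it.\<close>
      then have "pverts G \<subseteq> \<Union>\<S>" using closed[OF \<S>(1,2)] by blast
      moreover obtain B where B: "B \<in> ?blocks" "verts B \<in> \<T> - \<S>" using \<S> by (auto simp: \<T>_def)
      moreover have "verts B \<subseteq> pverts G" using B(2) V by blast
      moreover have "verts B \<noteq> {}" using three[OF B(1)] by auto
      ultimately show False using none by blast
    qed
  qed (use T1[unfolded shared_def] in blast)+
  then show ?thesis using G card by simp
qed

theorem mainTheorem2:
  fixes n t :: nat
    and A :: "'a pair_pre_digraph" and u :: 'a
    and B :: "'b pair_pre_digraph" and v :: 'b
  assumes "n \<ge> 1" and "t \<le> (n - 1) div 2"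
    and "is_Q (t div 2) A" and "attachment_vertex A u"
    and "is_Q (t - t div 2) B" and "attachment_vertex B v"
  shows "kirchhoff_index (C_graph n t A u B v) =
    (if even t
     then 1 / 18 * (3 * real n ^ 3 - 3 * real n - 12 * real n * real t ^ 2 - 6 * real n * real t
                    + 8 * real t ^ 3 + 12 * real t ^ 2 - 2 * real t)
     else 1 / 18 * (3 * real n ^ 3 - 15 * real n - 12 * real n * real t ^ 2 - 6 * real n * real t
                    + 8 * real t ^ 3 + 12 * real t ^ 2 + 22 * real t + 12))"
proof -
  obtain a where "triangle_chain (t div 2) u a A" using is_Q_triangle_chain[OF assms(3,4)] by blast
  moreover obtain b where "triangle_chain (t - t div 2) v b B"
    using is_Q_triangle_chain[OF assms(5,6)] by blast
  ultimately show ?thesis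
    by (rule kirchhoff_index_C_graph_triangle_chains[OF assms(1,2)])
qed

end
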